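(* Let $k,K\geq 1$ be integers. There is a function $R\colon(0,\infty)\to[0,\infty)$ depending only on $k,K$ such that the following holds. Let $X$ be a set and let $f_1,\ldots,f_k\colon X\to X$ be pairwise commuting maps all of whose fibers have cardinality at most $K$. Then the graph on $X$ with edges $\{x,f_j(x)\}$ ($x\in X$, $1\le j\le k$) has asymptotic dimension at most $k$, with control function $R$.
   Context: Loops are discarded, and the graph is given its path metric $d$, with value $\infty$ between different connected components. Asymptotic dimension: let $(X,d)$ be a metric space, possibly with infinite distances. The $r$-components of a subset are the equivalence classes generated by $r$-chains, i.e. finite sequences of points of the subset with successive distances at most $r$. The space has asymptotic dimension at most $n$ with control function $R$ if for every $r>0$ there is a cover $U_0,\dots,U_n$ of $X$ (empty members allowed) such that every $r$-component of each $U_i$ has diameter at most $R(r)<\infty$. *)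

theory Defs
  imports Complex_Main "HOL-Library.Extended_Nonnegative_Real" "HOL-Library.FuncSet"
begin

text \<open>An edge is an unordered pair of vertices, so a set of edges is a set of two-element sets.
  The infimum of the empty set is \<open>\<infinity>\<close>, which is the distance between different components.\<close>

definition path_metric :: "'a set set \<Rightarrow> 'a \<Rightarrow> 'a \<Rightarrow> ennreal" where
  "path_metric E x y = (INF n\<in>{n. (x, y) \<in> {(u, v). {u, v} \<in> E} ^^ n}. of_nat n)"

definition maps_edges :: "'a set \<Rightarrow> nat \<Rightarrow> (nat \<Rightarrow> 'a \<Rightarrow> 'a) \<Rightarrow> 'a set set" where
  "maps_edges X k f = {{x, f j x} | x j. x \<in> X \<and> j \<in> {1..k} \<and> f j x \<noteq> x}"

definition ext_diameter :: "('a \<Rightarrow> 'a \<Rightarrow> ennreal) \<Rightarrow> 'a set \<Rightarrow> ennreal" where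
  "ext_diameter d A = (SUP (x, y)\<in>A \<times> A. d x y)"

text \<open>The reflexive transitive closure contains the whole diagonal of the type, but only classes
  of points of \<open>A\<close> are formed, and a chain starting in \<open>A\<close> stays in \<open>A\<close>.\<close>

definition r_components :: "('a \<Rightarrow> 'a \<Rightarrow> ennreal) \<Rightarrow> real \<Rightarrow> 'a set \<Rightarrow> 'a set set" where
  "r_components d r A = A // {(x, y). x \<in> A \<and> y \<in> A \<and> d x y \<le> ennreal r}\<^sup>*"

definition asdim_at_most ::
    "'a set \<Rightarrow> ('a \<Rightarrow> 'a \<Rightarrow> ennreal) \<Rightarrow> nat \<Rightarrow> (real \<Rightarrow> real) \<Rightarrow> bool" where
  "asdim_at_most X d n R \<longleftrightarrow>
    (\<forall>r>0. \<exists>U :: nat \<Rightarrow> 'a set. (\<Union>i\<le>n. U i) = X \<and>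
       (\<forall>i\<le>n. \<forall>C\<in>r_components d r (U i). ext_diameter d C \<le> ennreal (R r)))"

definition commuting_maps :: "'a set \<Rightarrow> nat \<Rightarrow> nat \<Rightarrow> (nat \<Rightarrow> 'a \<Rightarrow> 'a) \<Rightarrow> bool" where
  "commuting_maps X k K f \<longleftrightarrow>
    (\<forall>j\<in>{1..k}. f j \<in> X \<rightarrow> X) \<and>
    (\<forall>i\<in>{1..k}. \<forall>j\<in>{1..k}. \<forall>x\<in>X. f i (f j x) = f j (f i x)) \<and>
    (\<forall>j\<in>{1..k}. \<forall>y\<in>X. finite {x \<in> X. f j x = y} \<and> card {x \<in> X. f j x = y} \<le> K)"

text \<open>The control function may depend on \<open>k\<close> and \<open>K\<close> only, in particular not on the type of the
  elements of \<open>X\<close>. A statement of the form \<open>\<exists>R. \<forall>X :: 'a set. \<dots>\<close> would allow a different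
  \<open>R\<close> for every type \<open>'a\<close>, and HOL has no quantifier over types that could be put below
  \<open>\<exists>R\<close>. Hence the control function is named by a closed term: an arbitrary one
  among those that work for all sets of natural numbers. Nothing is assumed about it; that
  it works for sets of any type has to be proved.\<close>

definition commuting_control :: "nat \<Rightarrow> nat \<Rightarrow> real \<Rightarrow> real" where
  "commuting_control k K = (SOME R. (\<forall>r>0. 0 \<le> R r) \<and>
     (\<forall>(X :: nat set) f. commuting_maps X k K f \<longrightarrow>
        asdim_at_most X (path_metric (maps_edges X k f)) k R))"

end

theory Submission
  imports Defs "HOL-Library.Function_Algebras"
begin

text \<open>
Commuting maps \<open>f\<^sub>1, \<dots>, f\<^sub>k\<close> are an action of the monoid \<open>\<nat>\<^sup>k\<close>, written \<open>a x\<close>; two points are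
close iff \<open>a x = b y\<close> for some small \<open>a\<close> and \<open>b\<close>. If a component carried an equivariant map \<open>u\<close> to
\<open>\<int>\<^sup>k\<close>, the theorem would be easy: pull back a cover of \<open>\<int>\<^sup>k\<close> by \<open>k + 1\<close> families of bounded sets. In an
\<open>r\<close>-chain \<open>x\<^sub>0, x\<^sub>1, \<dots>\<close> whose displacements \<open>c\<^sub>i = u(x\<^sub>i) - u(x\<^sub>0)\<close> stay in a box, the points
\<open>(h - c\<^sub>i) x\<^sub>i\<close> all coincide once \<open>h\<close> exceeds the box (the common image of neighbours is reached below
height \<open>h\<close>), so the chain is bounded, however much the maps branch backwards. The obstruction to such a
map \<open>u\<close> are relations \<open>a x = b x\<close> with \<open>a \<noteq> b\<close>. They differ from point to point and may become visible
only far up. Two ideas deal with them.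

\<^bold>\<open>Noetherian induction over relations.\<close> Let \<open>L\<close> be a subgroup of \<open>\<int>\<^sup>k\<close> all of whose elements act trivially
from some height on: \<open>(h + v) x = h x\<close>, with \<open>h\<close> depending on \<open>v\<close> only. The points which satisfy a further
relation \<open>(H + v) x = H x\<close>, with \<open>v \<notin> L\<close> in a fixed box, form finitely many forward closed subsystems,
each with a strictly larger subgroup. By the ascending chain condition (\<open>wf_lattices\<close>) these may be
assumed to be covered already, and \<open>coverable_Un\<close> joins them to a cover of all other points
(\<open>controlled_step\<close>).

\<^bold>\<open>Region growing in \<open>\<int>\<^sup>k / L\<close>.\<close> The points \<open>(H + v) x\<close> above a point \<open>x\<close> are indexed by
\<open>\<int>\<^sup>k / L\<close>, whose balls of radius \<open>n\<close> have at most \<open>(2n + 1)\<^sup>k\<close> elements. If \<open>x\<close> satisfies no such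
further relation, then \<open>H x\<close> differs from the points at nearby indices. For spaces of polynomial growth Papasoglu's argument gives the dimension bound:
centres take balls from what is left, with radii chosen such that the rim of the ball is sparse compared to
the ball; the balls are bounded and far apart, and the union of the rims is thinner by a factor \<open>D\<close>. After
\<open>k\<close> rounds the remaining set is so thin that its \<open>r\<close>-components are bounded (\<open>piece_component\<close>). To obtain
subsets of \<open>X\<close>, every point runs this procedure on the pattern which it sees above itself and asks in which
piece the origin lies. The answers of neighbouring points fit together because the procedure is
translation invariant and local (\<open>piece_agree\<close>): centres are processed colour by colour, for a colouring of
\<open>X\<close> by finitely many colours in which distinct points with a near common ancestor differ. Here the
bound \<open>K\<close> on the fibres enters (\<open>ancestor_colouring\<close>): the number of colours bounds the number of rounds,
hence the height up to which a point has to look.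

This yields a control function for systems on sets of natural numbers. Every component of a system
is countable, being connected by finite-to-one maps, so the control function that the
definition of \<open>commuting_control\<close> selects for sets of natural numbers serves every type.
\<close>


section \<open>Covers at one scale and their unions\<close>

text \<open>One scale of asymptotic dimension, with an arbitrary family of closeness relations \<open>N\<close> in place of the
metric: the same notion is used for the graph metric and for common images.\<close>

definition coverable :: "(nat \<Rightarrow> 'a \<Rightarrow> 'a \<Rightarrow> bool) \<Rightarrow> 'a set \<Rightarrow> nat \<Rightarrow> nat \<Rightarrow> nat \<Rightarrow> bool" where
  "coverable N X n r D \<longleftrightarrow> (\<exists>U :: nat \<Rightarrow> 'a set. (\<Union>i\<le>n. U i) = X \<and>
     (\<forall>i\<le>n. \<forall>x\<in>U i. \<forall>y. (x, y) \<in> {(x, y). x \<in> U i \<and> y \<in> U i \<and> N r x y}\<^sup>* \<longrightarrow> N D x y))"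

lemma coverable_cases:
  assumes "coverable N X n r D"
  obtains U where "(\<Union>i\<le>n. U i) = X"
    and "\<And>i x y. i \<le> n \<Longrightarrow> x \<in> U i \<Longrightarrow>
      (x, y) \<in> {(x, y). x \<in> U i \<and> y \<in> U i \<and> N r x y}\<^sup>* \<Longrightarrow> N D x y"
  using assms unfolding coverable_def by blast

locale nearness =
  fixes N :: "nat \<Rightarrow> 'a \<Rightarrow> 'a \<Rightarrow> bool" and X :: "'a set"
  assumes near_refl: "x \<in> X \<Longrightarrow> N n x x"
    and near_trans: "x \<in> X \<Longrightarrow> y \<in> X \<Longrightarrow> z \<in> X \<Longrightarrow> N m x y \<Longrightarrow> N n y z \<Longrightarrow> N (m + n) x z"
    and near_mono: "x \<in> X \<Longrightarrow> y \<in> X \<Longrightarrow> m \<le> n \<Longrightarrow> N m x y \<Longrightarrow> N n x y"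
begin

text \<open>The sets of the two covers may simply be united. In a chain inside such a union, consecutive points of the
second cover are separated by a stretch of the first cover, which has diameter at most \<open>D\<close>; hence these points
form a chain of step \<open>D + 2r\<close>, which is the scale required of the second cover.\<close>

lemma coverable_Un:
  assumes "A \<subseteq> X" "B \<subseteq> X" and A: "coverable N A n r D" and B: "coverable N B n (D + 2 * r) E"
  shows "coverable N (A \<union> B) n r (E + 2 * (D + r))"
proof -
  from A obtain U where U: "(\<Union>i\<le>n. U i) = A" and U': "\<And>i x y. \<lbrakk>i \<le> n; x \<in> U i;
      (x, y) \<in> {(x, y). x \<in> U i \<and> y \<in> U i \<and> N r x y}\<^sup>*\<rbrakk> \<Longrightarrow> N D x y"
    by (rule coverable_cases) (rule that)
  from B obtain W where W: "(\<Union>i\<le>n. W i) = B" and W': "\<And>i x y. \<lbrakk>i \<le> n; x \<in> W i;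
      (x, y) \<in> {(x, y). x \<in> W i \<and> y \<in> W i \<and> N (D + 2 * r) x y}\<^sup>*\<rbrakk> \<Longrightarrow> N E x y"
    by (rule coverable_cases) (rule that)
  have "N (E + 2 * (D + r)) x y"
    if i: "i \<le> n" and x: "x \<in> U i \<union> W i"
      and xy: "(x, y) \<in> {(x, y). x \<in> U i \<union> W i \<and> y \<in> U i \<union> W i \<and> N r x y}\<^sup>*" for i x y
  proof -
    let ?RU = "{(x, y). x \<in> U i \<and> y \<in> U i \<and> N r x y}"
    let ?RW = "{(x, y). x \<in> W i \<and> y \<in> W i \<and> N (D + 2 * r) x y}"
    have UX: "U i \<subseteq> X" and WX: "W i \<subseteq> X" using U W i assms by auto
    \<comment> \<open>Where a chain can be: still in the first cover, at a point of the second cover, or in a later stretch of the first cover, left at \<open>w'\<close> and entered at \<open>v\<close>.\<close>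
    have far: "(u \<in> U i \<and> N D x u \<and> (x, u) \<in> ?RU\<^sup>*) \<or> (u \<in> W i \<and> (\<exists>w\<in>W i. N (D + r) x w \<and> (w, u) \<in> ?RW\<^sup>*))
       \<or> (\<exists>w\<in>W i. \<exists>w'\<in>W i. \<exists>v\<in>U i. N (D + r) x w \<and> (w, w') \<in> ?RW\<^sup>* \<and> N r w' v \<and> (v, u) \<in> ?RU\<^sup>* \<and> u \<in> U i)"
      if "(x, u) \<in> {(x, y). x \<in> U i \<union> W i \<and> y \<in> U i \<union> W i \<and> N r x y}\<^sup>*" for u
      using that
    proof (induction rule: rtrancl_induct)
      case base
      show ?case
      proof (cases "x \<in> U i")
        case True
        then show ?thesis using UX near_refl by auto
      next
        case False
        then have "x \<in> W i" using x by auto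
        then show ?thesis using WX near_refl by blast
      qed
    next
      case (step u z)
      have z: "z \<in> U i \<or> z \<in> W i" and uz: "N r u z" and u: "u \<in> U i \<union> W i" using step(2) by auto
      have uX: "u \<in> X" and zX: "z \<in> X" and xX: "x \<in> X" using z u x UX WX by auto
      from step.IH consider (1) "u \<in> U i" "N D x u" "(x, u) \<in> ?RU\<^sup>*"
        | (2) w where "u \<in> W i" "w \<in> W i" "N (D + r) x w" "(w, u) \<in> ?RW\<^sup>*"
        | (3) w w' v where "w \<in> W i" "w' \<in> W i" "v \<in> U i" "N (D + r) x w" "(w, w') \<in> ?RW\<^sup>*"
            "N r w' v" "(v, u) \<in> ?RU\<^sup>*" "u \<in> U i"
        by blast
      then show ?case
      proof cases
        case 1
        show ?thesis
        proof (cases "z \<in> U i")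
          case True
          have xU: "x \<in> U i" by (rule converse_rtranclE[OF 1(3)]) (use 1(1) in auto)
          have "(x, z) \<in> ?RU\<^sup>*" using 1 True uz by (auto intro: rtrancl_into_rtrancl)
          then show ?thesis using True U'[OF i xU] by blast
        next
          case False
          then have "z \<in> W i" using z by auto
          moreover have "N (D + r) x z" using near_trans[OF xX uX zX] 1 uz by auto
          ultimately show ?thesis by blast
        qed
      next
        case 2
        show ?thesis
        proof (cases "z \<in> W i")
          case True
          have "N (D + 2 * r) u z" by (rule near_mono[OF uX zX _ uz]) simp
          then have "(w, z) \<in> ?RW\<^sup>*" using 2 True by (auto intro: rtrancl_into_rtrancl)
          then show ?thesis using True 2 by blast
        next
          case False
          then show ?thesis using z 2 uz by blast
        qed
      next
        case 3
        show ?thesis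
        proof (cases "z \<in> U i")
          case True
          then have "(v, z) \<in> ?RU\<^sup>*" using 3 uz by (auto intro: rtrancl_into_rtrancl)
          then show ?thesis using True 3 by blast
        next
          case False
          then have zW: "z \<in> W i" using z by auto
          have vX: "v \<in> X" "w' \<in> X" using 3 UX WX by auto
          have "N D v u" using U'[OF i 3(3,7)] .
          then have "N (r + (D + r)) w' z" using near_trans vX uX zX 3 uz by blast
          then have "N (D + 2 * r) w' z" by (simp add: add_ac mult_2)
          then have "(w, z) \<in> ?RW\<^sup>*" using 3 zW by (auto intro: rtrancl_into_rtrancl)
          then show ?thesis using 3 zW by blast
        qed
      qed
    qed
    from far[OF xy] consider (1) "y \<in> U i" "N D x y"
        | (2) w where "y \<in> W i" "w \<in> W i" "N (D + r) x w" "(w, y) \<in> ?RW\<^sup>*"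
        | (3) w w' v where "w \<in> W i" "w' \<in> W i" "v \<in> U i" "N (D + r) x w" "(w, w') \<in> ?RW\<^sup>*"
            "N r w' v" "(v, y) \<in> ?RU\<^sup>*" "y \<in> U i"
        by blast
    then show ?thesis
    proof cases
      case 1
      then show ?thesis by (intro near_mono[OF _ _ _ 1(2)]) (use x UX WX in auto)
    next
      case 2
      have "N E w y" using W'[OF i 2(2,4)] .
      then have "N (D + r + E) x y" using near_trans[of x w y] 2 x UX WX by blast
      then show ?thesis by (rule near_mono[rotated 3]) (use 2 x UX WX in auto)
    next
      case 3
      have X: "x \<in> X" "w \<in> X" "w' \<in> X" "v \<in> X" "y \<in> X" using 3 x UX WX by auto
      have "N E w w'" using W'[OF i 3(1,5)] .
      moreover have "N D v y" using U'[OF i 3(3,7)] .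
      ultimately have "N (D + r + (E + (r + D))) x y" using near_trans X 3 by blast
      then show ?thesis by (rule near_mono[rotated 3]) (use X in auto)
    qed
  qed
  moreover have "(\<Union>i\<le>n. U i \<union> W i) = A \<union> B" using U W by auto
  ultimately show ?thesis unfolding coverable_def by (intro exI[of _ "\<lambda>i. U i \<union> W i"]) blast
qed

end

section \<open>Numerical parameters\<close>

lemma poly_less_exp: "\<exists>w\<ge>1::nat. c * w ^ n < (2::nat) ^ w"
proof -
  define z where "z = 2 * n + c + 1"
  have zz: "z < 2 ^ z" and c: "c < 2 ^ c" by (rule less_exp)+
  \<comment> \<open>Taking \<open>w\<close> to be a power of two turns the claim into a linear bound on exponents.\<close>
  define w where "w = (2::nat) ^ (2 * z)"
  have "2 * z * n + c \<le> z * z" by (simp add: z_def algebra_simps)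
  also have "\<dots> \<le> 2 ^ z * 2 ^ z" using zz by (intro mult_mono) auto
  also have "\<dots> = w" by (simp add: w_def mult_2 power_add)
  finally have le: "2 * z * n + c \<le> w" .
  have "c * w ^ n < 2 ^ c * w ^ n" using c by (simp add: w_def)
  also have "\<dots> = 2 ^ (2 * z * n + c)" by (simp add: w_def power_mult power_add)
  also have "\<dots> \<le> 2 ^ w" using le by (intro power_increasing) auto
  finally show ?thesis by (intro exI[of _ w]) (simp add: w_def)
qed

lemma double_power_le: "D \<ge> 1 \<Longrightarrow> 2 * D ^ D \<le> (D + 1 :: nat) ^ D"
proof -
  assume D: "D \<ge> 1"
  have "2 \<le> 1 + real D * (1 / real D)" using D by simp
  also have "\<dots> \<le> (1 + 1 / real D) ^ D" by (rule Bernoulli_inequality) (simp add: le_divide_eq)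
  also have "1 + 1 / real D = real (D + 1) / real D" using D by (simp add: field_simps)
  also have "\<dots> ^ D = real (D + 1) ^ D / real D ^ D" by (rule power_divide)
  finally have "2 * real D ^ D \<le> real (D + 1) ^ D" using D by (simp add: le_divide_eq)
  then have "real (2 * D ^ D) \<le> real ((D + 1) ^ D)" by simp
  then show ?thesis by (simp only: of_nat_le_iff)
qed

text \<open>The parameters of the region growing: \<open>t\<close> is the number of candidate radii, and a rim contains at most the
fraction \<open>1/D\<close> of its ball. The first inequality says that a ball cannot grow by the factor \<open>1 + 1/D\<close> at
each of the \<open>t\<close> steps, the second one that \<open>k\<close> thinnings by the factor \<open>D\<close> leave fewer than \<open>t\<close> points.
With \<open>t\<close> of order \<open>u\<^bsup>2k\<^esup>\<close> and \<open>D\<close> of order \<open>u\<^bsup>2k-1\<^esup>\<close> the second one holds by the factor \<open>u\<^sup>k\<close>, and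
the first one because \<open>t/D\<close> is proportional to \<open>u\<close>, so that the right-hand side wins exponentially.\<close>

lemma growth_constants:
  fixes k r :: nat
  assumes k: "k \<ge> 1" and r: "r \<ge> 1"
  shows "\<exists>t D. D \<ge> 1 \<and> t \<ge> 1 \<and> D ^ t * (2 * (t * r) + 1) ^ k < (D + 1) ^ t \<and>
     (2 * (t * r + 2 * ((t + 1) * r) * k) + 1) ^ k < t * D ^ k"
proof -
  define q where "q = (8 * k + 3) * r"
  have q: "q \<ge> 2" using r k by (cases r) (auto simp: q_def)
  obtain w where w: "w \<ge> 1" "(3 * r * q ^ (2 * k)) ^ k * w ^ (2 * k * k) < (2::nat) ^ w"
    using poly_less_exp by blast
  define u where "u = q * w"
  have u: "u \<ge> 2" using q w by (metis One_nat_def le_trans mult_le_mono nat_mult_1_right u_def)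
  define t where "t = u ^ (2 * k)"
  define D where "D = q * u ^ (2 * k - 1)"
  have "u ^ (2 * k) = u * u ^ (2 * k - 1)" using k power_minus_mult[of "2 * k" u] by (simp add: mult.commute)
  then have t: "t = D * w" unfolding t_def D_def by (simp add: u_def mult_ac)
  have t1: "t \<ge> 1" and D1: "D \<ge> 1" using u q by (simp_all add: t_def D_def)
  have tr: "t * r \<ge> 1" using t1 r by (metis mult_le_mono nat_mult_1)
  have "(2 * (t * r) + 1) ^ k \<le> (3 * (t * r)) ^ k" using tr by (intro power_mono) auto
  also have "\<dots> = (3 * r * q ^ (2 * k)) ^ k * w ^ (2 * k * k)"
    by (simp add: t_def u_def power_mult_distrib power_mult[symmetric] mult_ac)
  also have "\<dots> < 2 ^ w" by (rule w)
  finally have "D ^ t * (2 * (t * r) + 1) ^ k < D ^ t * 2 ^ w" using D1 by simp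
  also have "\<dots> = (2 * D ^ D) ^ w" by (simp add: t power_mult power_mult_distrib)
  also have "\<dots> \<le> ((D + 1) ^ D) ^ w" by (intro power_mono double_power_le D1) simp
  also have "\<dots> = (D + 1) ^ t" by (simp add: t power_mult)
  finally have 1: "D ^ t * (2 * (t * r) + 1) ^ k < (D + 1) ^ t" .
  have "2 * (t * r + 2 * ((t + 1) * r) * k) + 1 \<le> t * q"
  proof -
    have "r * k \<le> t * r * k" using t1 by simp
    moreover have "2 * (t * r + 2 * ((t + 1) * r) * k) + 1 = 2 * (t * r) + 4 * (t * r * k) + 4 * (r * k) + 1"
      by (simp add: algebra_simps)
    moreover have "t * q = 8 * (t * r * k) + 3 * (t * r)" by (simp add: q_def algebra_simps)
    ultimately show ?thesis using tr by linarith
  qed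
  then have "(2 * (t * r + 2 * ((t + 1) * r) * k) + 1) ^ k \<le> (t * q) ^ k" by (intro power_mono) auto
  also have "\<dots> = q ^ k * u ^ (2 * k * k)"
    by (simp add: t_def power_mult_distrib power_mult)
  also have "\<dots> < q ^ k * u ^ (2 * k + (2 * k - 1) * k)"
  proof -
    have "2 * k * k < 2 * k + (2 * k - 1) * k" using k
      by (cases k) (auto simp: algebra_simps)
    then show ?thesis using u q by (simp add: power_strict_increasing)
  qed
  also have "\<dots> = t * D ^ k"
    by (simp add: t_def D_def power_mult_distrib power_mult power_add)
  finally show ?thesis using 1 t1 D1 by blast
qed




section \<open>Region growing in a space of bounded growth\<close>

definition ball_in :: "('p \<Rightarrow> 'p \<Rightarrow> nat) \<Rightarrow> 'p set \<Rightarrow> 'p \<Rightarrow> nat \<Rightarrow> 'p set" where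
  "ball_in d A p n = {q \<in> A. d p q \<le> n}"

text \<open>The disjunct \<open>i \<ge> t\<close> makes the radius depend on the ball of radius \<open>t * r\<close> only, without any hypothesis on
growth; \<open>radius_bound\<close> shows that it is not attained under the growth hypothesis.\<close>

definition radius :: "('p \<Rightarrow> 'p \<Rightarrow> nat) \<Rightarrow> nat \<Rightarrow> nat \<Rightarrow> nat \<Rightarrow> 'p set \<Rightarrow> 'p \<Rightarrow> nat" where
  "radius d r t D A p = (LEAST i. i \<ge> t \<or>
     D * card (ball_in d A p (Suc i * r) - ball_in d A p (i * r)) \<le> card (ball_in d A p (i * r)))"

text \<open>One round: every remaining centre of colour \<open>s\<close> takes away its ball together with the rim of width \<open>r\<close>.\<close>

definition carve :: "('p \<Rightarrow> 'p \<Rightarrow> nat) \<Rightarrow> nat \<Rightarrow> nat \<Rightarrow> nat \<Rightarrow> ('p \<Rightarrow> nat) \<Rightarrow> nat \<Rightarrow> 'p set \<Rightarrow> 'p set" where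
  "carve d r t D c s A = {p \<in> A. \<forall>q\<in>A. c q = s \<longrightarrow> Suc (radius d r t D A q) * r < d q p}"

primrec live :: "('p \<Rightarrow> 'p \<Rightarrow> nat) \<Rightarrow> nat \<Rightarrow> nat \<Rightarrow> nat \<Rightarrow> ('p \<Rightarrow> nat) \<Rightarrow> 'p set \<Rightarrow> nat \<Rightarrow> 'p set" where
  "live d r t D c A 0 = A"
| "live d r t D c A (Suc s) = carve d r t D c s (live d r t D c A s)"

definition cell :: "('p \<Rightarrow> 'p \<Rightarrow> nat) \<Rightarrow> nat \<Rightarrow> nat \<Rightarrow> nat \<Rightarrow> ('p \<Rightarrow> nat) \<Rightarrow> 'p set \<Rightarrow> 'p \<Rightarrow> 'p set" where
  "cell d r t D c A q = (let B = live d r t D c A (c q) in ball_in d B q (radius d r t D B q * r))"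

definition rim :: "('p \<Rightarrow> 'p \<Rightarrow> nat) \<Rightarrow> nat \<Rightarrow> nat \<Rightarrow> nat \<Rightarrow> ('p \<Rightarrow> nat) \<Rightarrow> 'p set \<Rightarrow> 'p \<Rightarrow> 'p set" where
  "rim d r t D c A q = (let B = live d r t D c A (c q) in
     ball_in d B q (Suc (radius d r t D B q) * r) - ball_in d B q (radius d r t D B q * r))"

text \<open>A centre is a point that survives until the round of its own colour. That round removes it, so
all points are gone after the last round.\<close>

definition centres :: "('p \<Rightarrow> 'p \<Rightarrow> nat) \<Rightarrow> nat \<Rightarrow> nat \<Rightarrow> nat \<Rightarrow> ('p \<Rightarrow> nat) \<Rightarrow> 'p set \<Rightarrow> 'p set" where
  "centres d r t D c A = {q \<in> A. q \<in> live d r t D c A (c q)}"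

definition rims :: "('p \<Rightarrow> 'p \<Rightarrow> nat) \<Rightarrow> nat \<Rightarrow> nat \<Rightarrow> nat \<Rightarrow> ('p \<Rightarrow> nat) \<Rightarrow> 'p set \<Rightarrow> 'p set" where
  "rims d r t D c A = (\<Union>q\<in>centres d r t D c A. rim d r t D c A q)"

text \<open>Only these points are partitioned, so that no properness assumption on the colouring is needed. Two
centres of the same colour have disjoint balls, the radii being at most \<open>t * r\<close>.\<close>

definition isolated :: "'p set \<Rightarrow> ('p \<Rightarrow> 'p \<Rightarrow> nat) \<Rightarrow> nat \<Rightarrow> nat \<Rightarrow> ('p \<Rightarrow> nat) \<Rightarrow> 'p set" where
  "isolated P d r t c = {p \<in> P. \<forall>q\<in>P. d p q \<le> 2 * (Suc t * r) \<longrightarrow> c q = c p \<longrightarrow> q = p}"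

primrec strata :: "'p set \<Rightarrow> ('p \<Rightarrow> 'p \<Rightarrow> nat) \<Rightarrow> nat \<Rightarrow> nat \<Rightarrow> nat \<Rightarrow> ('p \<Rightarrow> nat) \<Rightarrow> nat \<Rightarrow> 'p set" where
  "strata P d r t D c 0 = isolated P d r t c"
| "strata P d r t D c (Suc j) = rims d r t D c (strata P d r t D c j)"

text \<open>The \<open>k + 1\<close> sets of the cover: the union of the cells in each of the \<open>k\<close> rounds of thinning, and
what is left at the end.\<close>

definition piece :: "'p set \<Rightarrow> ('p \<Rightarrow> 'p \<Rightarrow> nat) \<Rightarrow> nat \<Rightarrow> nat \<Rightarrow> nat \<Rightarrow> ('p \<Rightarrow> nat) \<Rightarrow> nat \<Rightarrow> nat \<Rightarrow> 'p set" where
  "piece P d r t D c k j = (if j < k then strata P d r t D c j - strata P d r t D c (Suc j)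
     else strata P d r t D c k)"

locale bounded_growth =
  fixes P :: "'p set" and d :: "'p \<Rightarrow> 'p \<Rightarrow> nat" and V :: "nat \<Rightarrow> nat"
  assumes dist_eq_0: "p \<in> P \<Longrightarrow> q \<in> P \<Longrightarrow> d p q = 0 \<longleftrightarrow> p = q"
    and dist_commute: "p \<in> P \<Longrightarrow> q \<in> P \<Longrightarrow> d p q = d q p"
    and dist_triangle: "p \<in> P \<Longrightarrow> q \<in> P \<Longrightarrow> u \<in> P \<Longrightarrow> d p u \<le> d p q + d q u"
    and finite_ball: "p \<in> P \<Longrightarrow> finite (ball_in d P p n)"
    and card_ball: "p \<in> P \<Longrightarrow> card (ball_in d P p n) \<le> V n"
begin

lemma ball_in_sub: "A \<subseteq> P \<Longrightarrow> ball_in d A p n \<subseteq> ball_in d P p n"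
  by (auto simp: ball_in_def)

lemma finite_ball_in: "A \<subseteq> P \<Longrightarrow> p \<in> P \<Longrightarrow> finite (ball_in d A p n)"
  by (rule finite_subset[OF ball_in_sub finite_ball])

lemma card_ball_in: "A \<subseteq> P \<Longrightarrow> p \<in> P \<Longrightarrow> card (ball_in d A p n) \<le> V n"
  by (rule order_trans[OF card_mono[OF finite_ball ball_in_sub] card_ball])

text \<open>If every candidate rim were large, the ball of radius \<open>t * r\<close> would have more than
\<open>(1 + 1/D)\<^sup>t\<close> points.\<close>

lemma radius_bound:
  assumes A: "A \<subseteq> P" "p \<in> A" and V: "D ^ t * V (t * r) < (D + 1) ^ t"
  shows "radius d r t D A p < t"
    and "D * card (ball_in d A p (Suc (radius d r t D A p) * r) - ball_in d A p (radius d r t D A p * r))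
      \<le> card (ball_in d A p (radius d r t D A p * r))"
proof -
  let ?b = "\<lambda>i. ball_in d A p (i * r)"
  have p: "p \<in> P" using A by auto
  have ex: "\<exists>i<t. D * card (?b (Suc i) - ?b i) \<le> card (?b i)"
  proof (rule ccontr)
    assume neg: "\<not> ?thesis"
    have "(D + 1) ^ i \<le> D ^ i * card (?b i)" if "i \<le> t" for i
      using that
    proof (induction i)
      case 0
      have "p \<in> ?b 0" using A p dist_eq_0[OF p p] by (simp add: ball_in_def)
      then have "card (?b 0) \<noteq> 0" using finite_ball_in[OF A(1) p] by auto
      then show ?case by simp
    next
      case (Suc i)
      have sub: "?b i \<subseteq> ?b (Suc i)" by (auto simp: ball_in_def)
      have fin: "finite (?b (Suc i))" "finite (?b i)" using finite_ball_in A p by auto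
      have "i < t" using Suc.prems by simp
      then have "card (?b i) < D * card (?b (Suc i) - ?b i)" using neg not_le by blast
      moreover have "card (?b (Suc i)) = card (?b i) + card (?b (Suc i) - ?b i)"
        using card_Diff_subset[OF fin(2) sub] card_mono[OF fin(1) sub] by linarith
      ultimately have "(D + 1) * card (?b i) \<le> D * card (?b (Suc i))" by (simp add: algebra_simps)
      then have "D ^ i * ((D + 1) * card (?b i)) \<le> D ^ i * (D * card (?b (Suc i)))" by simp
      then show ?case using Suc by (simp add: algebra_simps) (meson Suc_leD add_mono mult_le_mono2 order_trans)
    qed
    then have "(D + 1) ^ t \<le> D ^ t * card (?b t)" by blast
    also have "\<dots> \<le> D ^ t * V (t * r)" using card_ball_in[OF A(1) p] by simp
    finally show False using V by simp
  qed
  let ?Q = "\<lambda>i. i \<ge> t \<or> D * card (?b (Suc i) - ?b i) \<le> card (?b i)"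
  obtain i where i: "i < t" "?Q i" using ex by blast
  then show lt: "radius d r t D A p < t"
    unfolding radius_def using Least_le[of ?Q i] by simp
  then show "D * card (?b (Suc (radius d r t D A p)) - ?b (radius d r t D A p)) \<le> card (?b (radius d r t D A p))"
    using LeastI[of ?Q i] i(2) unfolding radius_def by auto
qed

lemma live_sub: "live d r t D c A s \<subseteq> A"
  by (induction s) (auto simp: carve_def)

lemma live_in: "A \<subseteq> P \<Longrightarrow> p \<in> live d r t D c A s \<Longrightarrow> p \<in> P"
  using live_sub by blast

lemma live_antimono: "s \<le> s' \<Longrightarrow> live d r t D c A s' \<subseteq> live d r t D c A s"
  by (induction rule: dec_induct) (auto simp: carve_def)

lemma rims_sub: "rims d r t D c A \<subseteq> A"
  using live_sub by (fastforce simp: rims_def rim_def ball_in_def Let_def)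

lemma cell_sub: "cell d r t D c A q \<subseteq> live d r t D c A (c q)"
  by (auto simp: cell_def ball_in_def Let_def)

lemma cell_in: "A \<subseteq> P \<Longrightarrow> p \<in> cell d r t D c A q \<Longrightarrow> p \<in> P"
  using cell_sub live_in by blast

lemma centres_in: "A \<subseteq> P \<Longrightarrow> q \<in> centres d r t D c A \<Longrightarrow> q \<in> P"
  by (auto simp: centres_def)

lemma removed_near_centre:
  assumes "q \<in> centres d r t D c A" "p \<in> live d r t D c A s" "c q < s"
  shows "Suc (radius d r t D (live d r t D c A (c q)) q) * r < d q p"
proof -
  have "p \<in> live d r t D c A (Suc (c q))"
    using assms(2,3) subsetD[OF live_antimono[of "Suc (c q)" s]] by (simp only: Suc_le_eq)
  then show ?thesis using assms by (auto simp: carve_def centres_def)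
qed

lemma in_cell:
  assumes A: "A \<subseteq> P" and p: "p \<in> A - rims d r t D c A"
  shows "\<exists>q\<in>centres d r t D c A. p \<in> cell d r t D c A q"
proof -
  have pP: "p \<in> P" using A p by auto
  have out: "p \<notin> live d r t D c A (Suc (c p))"
    using dist_eq_0[OF pP pP] by (auto simp: carve_def)
  have "\<exists>s. p \<in> live d r t D c A s \<and> p \<notin> live d r t D c A (Suc s)"
  proof (rule ccontr)
    assume "\<not> ?thesis"
    then have "p \<in> live d r t D c A s" for s using p by (induction s) auto
    then show False using out by blast
  qed
  then obtain s where s: "p \<in> live d r t D c A s" "p \<notin> live d r t D c A (Suc s)" by blast
  then obtain q where q: "q \<in> live d r t D c A s" "c q = s"
      "d q p \<le> Suc (radius d r t D (live d r t D c A s) q) * r"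
    by (auto simp: carve_def not_less)
  then have qc: "q \<in> centres d r t D c A" using live_sub by (fastforce simp: centres_def)
  then have "p \<notin> rim d r t D c A q" using p by (auto simp: rims_def)
  then have "p \<in> cell d r t D c A q" using q s by (auto simp: cell_def rim_def Let_def ball_in_def)
  then show ?thesis using qc by blast
qed

text \<open>Cells are \<open>r\<close>-separated because the rims are not part of any cell and are removed together with the cells:
a point within \<open>r\<close> of a cell that is still present lies in the cell or its rim, and one that has been removed
earlier would have taken the cell's point along.\<close>

lemma cell_step:
  assumes A: "A \<subseteq> P" and q: "q \<in> centres d r t D c A" and p: "p \<in> cell d r t D c A q"
    and p': "p' \<in> A - rims d r t D c A" and pp': "d p p' \<le> r"
  shows "p' \<in> cell d r t D c A q"
proof -
  have P: "p \<in> P" "p' \<in> P" "q \<in> P"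
    using cell_in[OF A p] p' A centres_in[OF A q] by auto
  have pl: "p \<in> live d r t D c A (c q)" using p cell_sub by blast
  have "p' \<in> live d r t D c A (c q)"
  proof (rule ccontr)
    assume not: "p' \<notin> live d r t D c A (c q)"
    obtain q' where q': "q' \<in> centres d r t D c A" "p' \<in> cell d r t D c A q'"
      using in_cell[OF A p'] by blast
    have q'P: "q' \<in> P" using q' A by (auto simp: centres_def)
    have "p' \<in> live d r t D c A (c q')" using q' cell_sub by blast
    then have "c q' < c q" using not live_antimono by (meson in_mono not_le)
    then have "Suc (radius d r t D (live d r t D c A (c q')) q') * r < d q' p"
      using removed_near_centre q' pl by blast
    moreover have "d q' p' \<le> radius d r t D (live d r t D c A (c q')) q' * r"
      using q'(2) by (auto simp: cell_def Let_def ball_in_def)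
    moreover have "d q' p \<le> d q' p' + d p' p" by (intro dist_triangle P q'P)
    moreover have "d p' p = d p p'" by (intro dist_commute P)
    ultimately show False using pp' by simp
  qed
  moreover have "d q p' \<le> d q p + d p p'" using dist_triangle P by auto
  moreover have "d q p \<le> radius d r t D (live d r t D c A (c q)) q * r"
    using p by (auto simp: cell_def Let_def ball_in_def)
  moreover have "p' \<notin> rim d r t D c A q" using p' q by (auto simp: rims_def)
  ultimately show ?thesis using pp' by (auto simp: cell_def rim_def Let_def ball_in_def)
qed

lemma cell_diameter:
  assumes A: "A \<subseteq> P" and V: "D ^ t * V (t * r) < (D + 1) ^ t"
    and p: "p \<in> A - rims d r t D c A"
    and pp': "(p, p') \<in> {(p, q). p \<in> A - rims d r t D c A \<and> q \<in> A - rims d r t D c A \<and> d p q \<le> r}\<^sup>*"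
  shows "d p p' \<le> 2 * (t * r)"
proof -
  obtain q where q: "q \<in> centres d r t D c A" "p \<in> cell d r t D c A q" using in_cell[OF A p] by blast
  have p': "p' \<in> cell d r t D c A q"
    using pp' by (induction rule: rtrancl_induct) (auto intro: q(2) cell_step[OF A q(1)])
  have P: "p \<in> P" "p' \<in> P" "q \<in> P"
    using cell_in[OF A q(2)] cell_in[OF A p'] centres_in[OF A q(1)] by auto
  let ?B = "live d r t D c A (c q)"
  have "radius d r t D ?B q < t"
    using q live_in[OF A] by (intro radius_bound V) (auto simp: centres_def)
  then have "radius d r t D ?B q * r \<le> t * r" by (intro mult_le_mono1) simp
  moreover have "d q p \<le> radius d r t D ?B q * r" "d q p' \<le> radius d r t D ?B q * r"
    using q(2) p' by (auto simp: cell_def Let_def ball_in_def)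
  moreover have "d p p' \<le> d p q + d q p'" by (intro dist_triangle P)
  moreover have "d p q = d q p" by (intro dist_commute P)
  ultimately show ?thesis by linarith
qed

text \<open>Each rim is charged to its own cell. Cells are disjoint, so their sizes add up.\<close>

lemma rims_sparse:
  assumes A: "A \<subseteq> isolated P d r t c" and V: "D ^ t * V (t * r) < (D + 1) ^ t" and y: "y \<in> P"
  shows "D * card (ball_in d (rims d r t D c A) y n) \<le> card (ball_in d A y (n + 2 * (Suc t * r)))"
proof -
  have AP: "A \<subseteq> P" using A by (auto simp: isolated_def)
  define L where "L = Suc t * r"
  have rad: "Suc (radius d r t D (live d r t D c A (c q)) q) * r \<le> L"
      "D * card (rim d r t D c A q) \<le> card (cell d r t D c A q)"
    if "q \<in> centres d r t D c A" for q
  proof -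
    have "live d r t D c A (c q) \<subseteq> P" "q \<in> live d r t D c A (c q)"
      using that live_in[OF AP] by (auto simp: centres_def)
    note b = radius_bound[OF this V]
    show "Suc (radius d r t D (live d r t D c A (c q)) q) * r \<le> L"
      unfolding L_def by (intro mult_le_mono1) (use b(1) in simp)
    show "D * card (rim d r t D c A q) \<le> card (cell d r t D c A q)"
      using b(2) by (simp add: rim_def cell_def Let_def)
  qed
  define I where "I = {q \<in> centres d r t D c A. rim d r t D c A q \<inter> ball_in d P y n \<noteq> {}}"
  have IP: "I \<subseteq> P" using AP by (auto simp: I_def centres_def)
  have rim_dist: "d q p \<le> L" if "q \<in> centres d r t D c A" "p \<in> rim d r t D c A q" for p q
    using that rad(1)[of q] by (auto simp: rim_def Let_def ball_in_def)
  have cell_dist: "d q p \<le> L" if "q \<in> centres d r t D c A" "p \<in> cell d r t D c A q" for p q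
    using that rad(1)[of q] by (auto simp: cell_def Let_def ball_in_def)
  have rimP: "rim d r t D c A q \<subseteq> P" and cellA: "cell d r t D c A q \<subseteq> A" for q
    using live_sub AP by (fastforce simp: rim_def cell_def Let_def ball_in_def)+
  have Iy: "d y q \<le> n + L" if q: "q \<in> I" for q
  proof -
    obtain p where p: "p \<in> rim d r t D c A q" "p \<in> P" "d y p \<le> n"
      using q by (auto simp: I_def ball_in_def)
    have qP: "q \<in> P" using q IP by auto
    have "d y q \<le> d y p + d p q" by (intro dist_triangle p y qP)
    moreover have "d p q = d q p" by (intro dist_commute p qP)
    ultimately have "d y q \<le> d y p + d q p" by simp
    then show ?thesis using p rim_dist[of q p] q by (auto simp: I_def)
  qed
  have finI: "finite I"
    by (rule finite_subset[OF _ finite_ball[OF y, of "n + L"]]) (use Iy IP in \<open>auto simp: ball_in_def\<close>)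
  have fin_rim: "finite (rim d r t D c A q)" if "q \<in> I" for q
    by (rule finite_subset[OF _ finite_ball[of q L]])
      (use that rim_dist rimP IP in \<open>auto simp: ball_in_def I_def\<close>)
  have cells_in: "(\<Union>q\<in>I. cell d r t D c A q) \<subseteq> ball_in d A y (n + 2 * L)"
  proof
    fix p assume "p \<in> (\<Union>q\<in>I. cell d r t D c A q)"
    then obtain q where q: "q \<in> I" "p \<in> cell d r t D c A q" by blast
    have "d y p \<le> d y q + d q p" using dist_triangle y q IP cellA AP by blast
    moreover have "d q p \<le> L" using cell_dist q by (auto simp: I_def)
    ultimately show "p \<in> ball_in d A y (n + 2 * L)" using Iy[OF q(1)] q cellA by (auto simp: ball_in_def)
  qed
  have disj: "cell d r t D c A q \<inter> cell d r t D c A q' = {}" if qq': "q \<in> I" "q' \<in> I" "q \<noteq> q'" for q q'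
  proof (rule ccontr)
    assume "cell d r t D c A q \<inter> cell d r t D c A q' \<noteq> {}"
    then obtain p where p: "p \<in> cell d r t D c A q" "p \<in> cell d r t D c A q'" by blast
    have qc: "q \<in> centres d r t D c A" "q' \<in> centres d r t D c A" using qq' by (auto simp: I_def)
    have lv: "p \<in> live d r t D c A (c q)" "p \<in> live d r t D c A (c q')" using p cell_sub by blast+
    have dq: "d q p \<le> radius d r t D (live d r t D c A (c q)) q * r"
      "d q' p \<le> radius d r t D (live d r t D c A (c q')) q' * r"
      using p by (auto simp: cell_def Let_def ball_in_def)
    have "\<not> c q < c q'" using removed_near_centre[OF qc(1) lv(2)] dq by auto
    moreover have "\<not> c q' < c q" using removed_near_centre[OF qc(2) lv(1)] dq by auto
    ultimately have cc: "c q' = c q" by simp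
    have pP: "p \<in> P" using p cellA AP by blast
    have qP: "q \<in> P" "q' \<in> P" using qq' IP by auto
    have "d q q' \<le> d q p + d p q'" by (intro dist_triangle pP qP)
    moreover have "d p q' = d q' p" by (intro dist_commute pP qP)
    ultimately have "d q q' \<le> 2 * L" using cell_dist[OF qc(1) p(1)] cell_dist[OF qc(2) p(2)] by simp
    then have "q' = q" using cc qq' A IP by (auto simp: L_def isolated_def I_def centres_def)
    then show False using qq' by simp
  qed
  have "ball_in d (rims d r t D c A) y n \<subseteq> (\<Union>q\<in>I. rim d r t D c A q)"
    using rimP by (fastforce simp: rims_def I_def ball_in_def)
  then have "card (ball_in d (rims d r t D c A) y n) \<le> card (\<Union>q\<in>I. rim d r t D c A q)"
    using finI fin_rim by (intro card_mono) auto
  also have "\<dots> \<le> (\<Sum>q\<in>I. card (rim d r t D c A q))" by (rule card_UN_le[OF finI])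
  finally have "D * card (ball_in d (rims d r t D c A) y n) \<le> D * (\<Sum>q\<in>I. card (rim d r t D c A q))" by simp
  also have "\<dots> = (\<Sum>q\<in>I. D * card (rim d r t D c A q))" by (simp add: sum_distrib_left)
  also have "\<dots> \<le> (\<Sum>q\<in>I. card (cell d r t D c A q))" by (intro sum_mono rad) (simp add: I_def)
  also have "\<dots> = card (\<Union>q\<in>I. cell d r t D c A q)"
  proof (rule card_UN_disjoint[symmetric])
    show "\<forall>i\<in>I. finite (cell d r t D c A i)"
      using cells_in finite_ball_in[OF AP y] by (meson UN_subset_iff finite_subset)
  qed (use finI disj in auto)
  also have "\<dots> \<le> card (ball_in d A y (n + 2 * L))"
    using cells_in finite_ball_in[OF AP y] by (intro card_mono)
  finally show ?thesis by (simp add: L_def)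
qed

lemma strata_sub: "strata P d r t D c j \<subseteq> isolated P d r t c"
proof (induction j)
  case (Suc j)
  then show ?case using rims_sub by fastforce
qed simp

lemma strata_sparse:
  assumes V: "D ^ t * V (t * r) < (D + 1) ^ t" and y: "y \<in> P"
  shows "D ^ j * card (ball_in d (strata P d r t D c j) y n) \<le> V (n + 2 * (Suc t * r) * j)"
proof (induction j arbitrary: n)
  case 0
  show ?case using card_ball_in[OF _ y] by (auto simp: isolated_def)
next
  case (Suc j)
  have "D ^ Suc j * card (ball_in d (strata P d r t D c (Suc j)) y n)
      \<le> D ^ j * card (ball_in d (strata P d r t D c j) y (n + 2 * (Suc t * r)))"
    using rims_sparse[OF strata_sub V y] by simp
  also have "\<dots> \<le> V (n + 2 * (Suc t * r) + 2 * (Suc t * r) * j)" by (rule Suc)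
  finally show ?case by (simp add: algebra_simps)
qed

text \<open>A chain that reaches distance \<open>t * r\<close> visits each of the \<open>t\<close> annuli of width \<open>r\<close> on its way.\<close>

lemma sparse_component:
  assumes S: "S \<subseteq> P" and p: "p \<in> S" and t: "t \<ge> 1" and r: "r \<ge> 1"
    and few: "card (ball_in d S p (t * r)) < t"
    and pp': "(p, p') \<in> {(p, q). p \<in> S \<and> q \<in> S \<and> d p q \<le> r}\<^sup>*"
  shows "d p p' \<le> t * r"
proof -
  have level: "j * r \<le> d p p' \<Longrightarrow> \<exists>q\<in>S. j * r \<le> d p q \<and> d p q < Suc j * r" for j
    using pp'
  proof (induction rule: rtrancl_induct)
    case base
    then show ?case using p r by (intro bexI[of _ p]) (use S dist_eq_0[of p p] in auto)
  next
    case (step q q')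
    show ?case
    proof (cases "j * r \<le> d p q")
      case True
      then show ?thesis using step by blast
    next
      case False
      have "d p q' \<le> d p q + d q q'" using step S p by (intro dist_triangle) auto
      then show ?thesis using False step by (intro bexI[of _ q']) auto
    qed
  qed
  show ?thesis
  proof (rule ccontr)
    assume far: "\<not> ?thesis"
    have "\<exists>q\<in>S. j * r \<le> d p q \<and> d p q < Suc j * r" if "j < t" for j
      using far that r by (intro level) (meson less_or_eq_imp_le mult_le_mono1 nat_le_linear order_trans)
    then obtain g where g: "\<And>j. j < t \<Longrightarrow> g j \<in> S \<and> j * r \<le> d p (g j) \<and> d p (g j) < Suc j * r"
      by metis
    have "inj_on g {..<t}"
    proof (rule inj_onI)
      fix i j assume ij: "i \<in> {..<t}" "j \<in> {..<t}" "g i = g j"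
      have "\<not> Suc i * r \<le> j * r" "\<not> Suc j * r \<le> i * r" using g[of i] g[of j] ij by fastforce+
      then show "i = j" by (metis Suc_leI linorder_neqE_nat mult_le_mono1)
    qed
    moreover have "g ` {..<t} \<subseteq> ball_in d S p (t * r)"
    proof
      fix q assume "q \<in> g ` {..<t}"
      then obtain j where j: "j < t" "q = g j" by auto
      have "Suc j * r \<le> t * r" using j by (intro mult_le_mono1) simp
      then show "q \<in> ball_in d S p (t * r)" using g[OF j(1)] j by (auto simp: ball_in_def)
    qed
    ultimately have "t \<le> card (ball_in d S p (t * r))"
      using card_inj_on_le[of g "{..<t}"] finite_ball_in[OF S] p S by force
    then show False using few by simp
  qed
qed

lemma piece_cover: "isolated P d r t c = (\<Union>j\<le>k. piece P d r t D c k j)"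
proof
  show "isolated P d r t c \<subseteq> (\<Union>j\<le>k. piece P d r t D c k j)"
  proof
    fix p assume p: "p \<in> isolated P d r t c"
    show "p \<in> (\<Union>j\<le>k. piece P d r t D c k j)"
    proof (cases "p \<in> strata P d r t D c k")
      case True
      then show ?thesis by (auto simp: piece_def intro!: bexI[of _ k])
    next
      case False
      have "\<exists>j<k. p \<in> strata P d r t D c j - strata P d r t D c (Suc j)"
        using False
      proof (induction k)
        case 0
        then show ?case using p by simp
      next
        case (Suc k)
        show ?case
        proof (cases "p \<in> strata P d r t D c k")
          case True
          then show ?thesis using Suc.prems by blast
        next
          case False
          then show ?thesis using Suc.IH less_SucI by blast
        qed
      qed
      then obtain j where "j < k" "p \<in> piece P d r t D c k j" by (auto simp: piece_def)
      then show ?thesis by (auto intro!: bexI[of _ j])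
    qed
  qed
qed (use strata_sub in \<open>fastforce simp: piece_def split: if_splits\<close>)

lemma piece_component:
  assumes V: "D ^ t * V (t * r) < (D + 1) ^ t" and V': "V (t * r + 2 * (Suc t * r) * k) < t * D ^ k"
    and r: "r \<ge> 1" and j: "j \<le> k" and p: "p \<in> piece P d r t D c k j"
    and pp': "(p, p') \<in> {(p, q). p \<in> piece P d r t D c k j \<and> q \<in> piece P d r t D c k j \<and> d p q \<le> r}\<^sup>*"
  shows "d p p' \<le> 2 * (t * r)"
proof (cases "j < k")
  case True
  have "strata P d r t D c j \<subseteq> P" using strata_sub by (fastforce simp: isolated_def)
  from cell_diameter[OF this V, of p c p'] show ?thesis using True p pp' by (simp add: piece_def)
next
  case False
  let ?S = "strata P d r t D c k"
  have S: "?S \<subseteq> P" using strata_sub by (fastforce simp: isolated_def)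
  have pS: "p \<in> ?S" using p False by (simp add: piece_def)
  have "D ^ k * card (ball_in d ?S p (t * r)) < t * D ^ k"
    by (rule le_less_trans[OF strata_sparse[OF V subsetD[OF S pS]] V'])
  then have "D ^ k * card (ball_in d ?S p (t * r)) < D ^ k * t" by (simp only: mult.commute)
  then have "card (ball_in d ?S p (t * r)) < t" by (simp only: mult_less_cancel1)
  then have "d p p' \<le> t * r"
    using sparse_component[OF S pS _ r] pp' False by (auto simp: piece_def)
  then show ?thesis by simp
qed

section \<open>Invariance and locality of region growing\<close>

text \<open>The rest of the section shows that membership of \<open>p\<close> in a piece is determined by the colours near \<open>p\<close>, and
is preserved by isometries. Both are treated at once: \<open>T\<close> is an isometry that carries one colouring to another one
on a ball around \<open>p\<close> only, and every operation shrinks the ball of agreement by a fixed amount.\<close>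

lemma rims_iff: "p \<in> rims d r t D c A \<longleftrightarrow> (\<exists>q\<in>A. q \<in> live d r t D c A (c q) \<and> p \<in> live d r t D c A (c q) \<and>
    radius d r t D (live d r t D c A (c q)) q * r < d q p \<and>
    d q p \<le> Suc (radius d r t D (live d r t D c A (c q)) q) * r)"
  by (auto simp: rims_def rim_def centres_def ball_in_def Let_def)

lemma radius_le: "radius d r t D A p \<le> t"
  unfolding radius_def by (rule Least_le) simp

lemma radius_reach: "Suc (radius d r t D A q) * r \<le> Suc t * r"
  by (intro mult_le_mono1) (simp add: radius_le)

context
  fixes T :: "'p \<Rightarrow> 'p"
  assumes T_bij: "bij_betw T P P" and T_dist: "p \<in> P \<Longrightarrow> q \<in> P \<Longrightarrow> d (T p) (T q) = d p q"
begin

definition agree :: "'p \<Rightarrow> nat \<Rightarrow> 'p set \<Rightarrow> 'p set \<Rightarrow> bool" where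
  "agree p R A' A \<longleftrightarrow> (\<forall>q\<in>P. d p q \<le> R \<longrightarrow> (q \<in> A' \<longleftrightarrow> T q \<in> A))"

lemma T_in: "p \<in> P \<Longrightarrow> T p \<in> P"
  using T_bij by (auto simp: bij_betw_def)

lemma T_surj: "u \<in> P \<Longrightarrow> \<exists>q\<in>P. u = T q"
  using T_bij by (auto simp: bij_betw_def)

lemma T_eq: "p \<in> P \<Longrightarrow> q \<in> P \<Longrightarrow> T p = T q \<longleftrightarrow> p = q"
  using T_bij by (auto simp: bij_betw_def inj_on_def)

lemma agree_shift: "\<lbrakk>agree p R A' A; p \<in> P; q \<in> P; d p q + n \<le> R\<rbrakk> \<Longrightarrow> agree q n A' A"
  unfolding agree_def by (meson add_left_mono dist_triangle le_trans)

lemma radius_agree: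
  assumes A: "A \<subseteq> P" "A' \<subseteq> P" and q: "q \<in> P" and ag: "agree q (t * r) A' A"
  shows "radius d r t D A' q = radius d r t D A (T q)"
proof -
  have image: "T ` ball_in d A' q n = ball_in d A (T q) n" if n: "n \<le> t * r" for n
  proof
    show "T ` ball_in d A' q n \<subseteq> ball_in d A (T q) n"
      using ag n A q T_dist by (fastforce simp: ball_in_def agree_def)
    show "ball_in d A (T q) n \<subseteq> T ` ball_in d A' q n"
    proof
      fix u assume u: "u \<in> ball_in d A (T q) n"
      then have "u \<in> P" using A by (auto simp: ball_in_def)
      then obtain v where v: "v \<in> P" "u = T v" using T_surj by blast
      then have "d q v \<le> n" using u T_dist q by (auto simp: ball_in_def)
      then have "v \<in> ball_in d A' q n" using u v ag n by (auto simp: ball_in_def agree_def)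
      then show "u \<in> T ` ball_in d A' q n" using v by blast
    qed
  qed
  have inj: "inj_on T P" using T_bij by (simp add: bij_betw_def)
  have sub: "ball_in d A' q n \<subseteq> P" for n using A by (auto simp: ball_in_def)
  have card_eq: "card (ball_in d A (T q) n) = card (ball_in d A' q n)" if "n \<le> t * r" for n
    using card_image[OF inj_on_subset[OF inj sub]] image[OF that] by metis
  have card_diff: "card (ball_in d A (T q) m - ball_in d A (T q) n) = card (ball_in d A' q m - ball_in d A' q n)"
    if "n \<le> t * r" "m \<le> t * r" for m n
  proof -
    have "T ` (ball_in d A' q m - ball_in d A' q n) = ball_in d A (T q) m - ball_in d A (T q) n"
      using image that inj_on_image_set_diff[OF inj, of "ball_in d A' q m" "ball_in d A' q n"] sub
      by (metis Diff_subset order_trans)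
    moreover have "inj_on T (ball_in d A' q m - ball_in d A' q n)"
      using inj_on_subset[OF inj sub] inj_on_diff by blast
    ultimately show ?thesis using card_image by metis
  qed
  have "(i \<ge> t \<or> D * card (ball_in d A' q (Suc i * r) - ball_in d A' q (i * r)) \<le> card (ball_in d A' q (i * r))) =
    (i \<ge> t \<or> D * card (ball_in d A (T q) (Suc i * r) - ball_in d A (T q) (i * r)) \<le> card (ball_in d A (T q) (i * r)))"
    for i
  proof (cases "i \<ge> t")
    case False
    then have "Suc i * r \<le> t * r" "i * r \<le> t * r" by (auto intro!: mult_le_mono1 simp del: mult_Suc)
    then show ?thesis by (simp only: card_eq card_diff)
  qed simp
  then show ?thesis unfolding radius_def by simp
qed

lemma carve_agree:
  assumes A: "A \<subseteq> P" "A' \<subseteq> P" and p: "p \<in> P" and ag: "agree p (R + 2 * (Suc t * r)) A' A"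
    and c: "\<And>q. q \<in> P \<Longrightarrow> d p q \<le> R + 2 * (Suc t * r) \<Longrightarrow> c' q = c (T q)"
  shows "agree p R (carve d r t D c' s A') (carve d r t D c s A)"
  unfolding agree_def
proof (intro ballI impI)
  fix u assume u: "u \<in> P" "d p u \<le> R"
  let ?L = "Suc t * r"
  have near: "q \<in> A' \<longleftrightarrow> T q \<in> A" "c' q = c (T q)" "radius d r t D A' q = radius d r t D A (T q)"
    if q: "q \<in> P" "d q u \<le> ?L" for q
  proof -
    have "d p q \<le> d p u + d u q" by (intro dist_triangle p u q)
    moreover have "d u q = d q u" by (intro dist_commute u q)
    ultimately have dpq: "d p q \<le> R + ?L" using u q by linarith
    then show "q \<in> A' \<longleftrightarrow> T q \<in> A" using ag q by (simp add: agree_def)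
    show "c' q = c (T q)" using c dpq q by simp
    have "t * r \<le> ?L" by simp
    then have "d p q + t * r \<le> R + 2 * ?L" using dpq by linarith
    then show "radius d r t D A' q = radius d r t D A (T q)"
      by (intro radius_agree A q agree_shift[OF ag p])
  qed
  have "(\<exists>q\<in>A'. c' q = s \<and> d q u \<le> Suc (radius d r t D A' q) * r) \<longleftrightarrow>
      (\<exists>q\<in>A. c q = s \<and> d q (T u) \<le> Suc (radius d r t D A q) * r)" (is "?l = ?r")
  proof
    assume ?l
    then obtain q where q: "q \<in> A'" "c' q = s" "d q u \<le> Suc (radius d r t D A' q) * r" by blast
    then have "q \<in> P" "d q u \<le> ?L" using A radius_reach le_trans by blast+
    then show ?r using near[of q] q T_dist u by (intro bexI[of _ "T q"]) auto
  next
    assume ?r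
    then obtain v where v: "v \<in> A" "c v = s" "d v (T u) \<le> Suc (radius d r t D A v) * r" by blast
    then obtain q where q: "q \<in> P" "v = T q" using A T_surj by blast
    have "d q u \<le> ?L" using v(3) q T_dist u radius_reach le_trans by metis
    then show ?l using near[of q] q v T_dist u by (intro bexI[of _ q]) auto
  qed
  moreover have "u \<in> A' \<longleftrightarrow> T u \<in> A" using ag u by (simp add: agree_def)
  ultimately show "u \<in> carve d r t D c' s A' \<longleftrightarrow> T u \<in> carve d r t D c s A"
    unfolding carve_def by (auto simp: not_less simp del: mult_Suc)
qed

lemma live_agree:
  assumes A: "A \<subseteq> P" "A' \<subseteq> P" and p: "p \<in> P" and ag: "agree p (R + 2 * (Suc t * r) * s) A' A"
    and c: "\<And>q. q \<in> P \<Longrightarrow> d p q \<le> R + 2 * (Suc t * r) * s \<Longrightarrow> c' q = c (T q)"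
  shows "agree p R (live d r t D c' A' s) (live d r t D c A s)"
  using ag c
proof (induction s arbitrary: R)
  case (Suc s)
  have e: "R + 2 * (Suc t * r) * Suc s = R + 2 * (Suc t * r) + 2 * (Suc t * r) * s" by (simp add: algebra_simps)
  have "agree p (R + 2 * (Suc t * r)) (live d r t D c' A' s) (live d r t D c A s)"
    using Suc.prems unfolding e by (intro Suc.IH) auto
  then show ?case unfolding live.simps
    by (rule carve_agree[rotated 3]) (use A p live_in Suc.prems(2) in auto)
qed simp

lemma rims_agree:
  assumes A: "A \<subseteq> P" "A' \<subseteq> P" and p: "p \<in> P" and m: "\<And>q. q \<in> P \<Longrightarrow> c q < m"
    and ag: "agree p (R + 2 * (Suc t * r) * Suc m) A' A"
    and c: "\<And>q. q \<in> P \<Longrightarrow> d p q \<le> R + 2 * (Suc t * r) * Suc m \<Longrightarrow> c' q = c (T q)"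
  shows "agree p R (rims d r t D c' A') (rims d r t D c A)"
  unfolding agree_def
proof (intro ballI impI)
  fix u assume u: "u \<in> P" "d p u \<le> R"
  let ?L = "Suc t * r"
  have lv: "agree p (R + 2 * ?L) (live d r t D c' A' s) (live d r t D c A s)" if "s \<le> m" for s
  proof (rule live_agree[OF A p])
    have le: "R + 2 * ?L + 2 * ?L * s \<le> R + 2 * ?L * Suc m"
      using mult_le_mono2[OF that, of "2 * ?L"] by (simp only: mult_Suc_right add.assoc add_left_mono)
    show "agree p (R + 2 * ?L + 2 * ?L * s) A' A" using ag le unfolding agree_def by (meson le_trans)
    show "c' q = c (T q)" if "q \<in> P" "d p q \<le> R + 2 * ?L + 2 * ?L * s" for q
      using c that le by (meson le_trans)
  qed
  have ag0: "agree p (R + 2 * ?L) A' A" using lv[of 0] by simp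
  have near: "q \<in> A' \<longleftrightarrow> T q \<in> A" "c' q = c (T q)"
      "v \<in> live d r t D c' A' (c (T q)) \<longleftrightarrow> T v \<in> live d r t D c A (c (T q))"
      "radius d r t D (live d r t D c' A' (c (T q))) q = radius d r t D (live d r t D c A (c (T q))) (T q)"
    if q: "q \<in> P" "d q u \<le> ?L" and v: "v = q \<or> v = u" for q v
  proof -
    have "d p q \<le> d p u + d u q" by (intro dist_triangle p u q)
    moreover have "d u q = d q u" by (intro dist_commute u q)
    ultimately have dpq: "d p q \<le> R + ?L" using u q by linarith
    then show "q \<in> A' \<longleftrightarrow> T q \<in> A" using ag0 q by (simp add: agree_def)
    have "R + ?L \<le> R + 2 * ?L * Suc m" by simp
    then show "c' q = c (T q)" using c dpq q by (meson le_trans)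
    have cm: "c (T q) \<le> m" using m[of "T q"] T_in q by (simp add: less_imp_le)
    show "v \<in> live d r t D c' A' (c (T q)) \<longleftrightarrow> T v \<in> live d r t D c A (c (T q))"
      using lv[OF cm] v q dpq u by (auto simp: agree_def)
    have "t * r \<le> ?L" by simp
    then have "d p q + t * r \<le> R + 2 * ?L" using dpq by linarith
    then show "radius d r t D (live d r t D c' A' (c (T q))) q = radius d r t D (live d r t D c A (c (T q))) (T q)"
      using live_in A by (intro radius_agree agree_shift[OF lv[OF cm] p] q) blast+
  qed
  show "u \<in> rims d r t D c' A' \<longleftrightarrow> T u \<in> rims d r t D c A"
  proof
    assume "u \<in> rims d r t D c' A'"
    then obtain q where q: "q \<in> A'" "q \<in> live d r t D c' A' (c' q)" "u \<in> live d r t D c' A' (c' q)"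
        "radius d r t D (live d r t D c' A' (c' q)) q * r < d q u"
        "d q u \<le> Suc (radius d r t D (live d r t D c' A' (c' q)) q) * r"
      unfolding rims_iff by blast
    have qP: "q \<in> P" "d q u \<le> ?L" using q A radius_reach le_trans by blast+
    note nr = near(1,2,4)[OF qP, of q, OF disjI1[OF refl]] near(3)[OF qP, of q, OF disjI1[OF refl]]
      near(3)[OF qP, of u, OF disjI2[OF refl]]
    show "T u \<in> rims d r t D c A" unfolding rims_iff
    proof (rule bexI[of _ "T q"])
      show "T q \<in> A" using q(1) nr(1) by simp
      show "T q \<in> live d r t D c A (c (T q)) \<and> T u \<in> live d r t D c A (c (T q)) \<and>
          radius d r t D (live d r t D c A (c (T q))) (T q) * r < d (T q) (T u) \<and>
          d (T q) (T u) \<le> Suc (radius d r t D (live d r t D c A (c (T q))) (T q)) * r"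
        using q(2-)[unfolded nr(2)] unfolding nr(3,4,5) T_dist[OF qP(1) u(1)] by (intro conjI)
    qed
  next
    assume "T u \<in> rims d r t D c A"
    then obtain v where v: "v \<in> A" "v \<in> live d r t D c A (c v)" "T u \<in> live d r t D c A (c v)"
        "radius d r t D (live d r t D c A (c v)) v * r < d v (T u)"
        "d v (T u) \<le> Suc (radius d r t D (live d r t D c A (c v)) v) * r"
      unfolding rims_iff by blast
    then obtain q where q: "q \<in> P" "v = T q" using A T_surj by blast
    have dq: "d q u \<le> ?L" using v(5) T_dist[OF q(1) u(1)] radius_reach le_trans unfolding q(2) by metis
    note nr = near(1,2,4)[OF q(1) dq, of q, OF disjI1[OF refl]] near(3)[OF q(1) dq, of q, OF disjI1[OF refl]]
      near(3)[OF q(1) dq, of u, OF disjI2[OF refl]]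
    show "u \<in> rims d r t D c' A'" unfolding rims_iff
    proof (rule bexI[of _ q])
      show "q \<in> A'" using q(2) v(1) nr(1) by simp
      show "q \<in> live d r t D c' A' (c' q) \<and> u \<in> live d r t D c' A' (c' q) \<and>
          radius d r t D (live d r t D c' A' (c' q)) q * r < d q u \<and>
          d q u \<le> Suc (radius d r t D (live d r t D c' A' (c' q)) q) * r"
        using v(2-) unfolding nr(2,3,4,5) q(2) T_dist[OF q(1) u(1)] by (intro conjI)
    qed
  qed
qed

lemma isolated_agree:
  assumes p: "p \<in> P" and c: "\<And>q. q \<in> P \<Longrightarrow> d p q \<le> R + 2 * (Suc t * r) \<Longrightarrow> c' q = c (T q)"
  shows "agree p R (isolated P d r t c') (isolated P d r t c)"
  unfolding agree_def
proof (intro ballI impI)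
  fix u assume u: "u \<in> P" "d p u \<le> R"
  have cu: "c' q = c (T q)" if "q \<in> P" "d u q \<le> 2 * (Suc t * r)" for q
    using c[OF that(1)] dist_triangle[OF p u(1) that(1)] that u by linarith
  have "c' u = c (T u)" using u dist_eq_0[of u u] by (intro cu) auto
  then have "(\<forall>q\<in>P. d u q \<le> 2 * (Suc t * r) \<longrightarrow> c' q = c' u \<longrightarrow> q = u) \<longleftrightarrow>
    (\<forall>q\<in>P. d (T u) (T q) \<le> 2 * (Suc t * r) \<longrightarrow> c (T q) = c (T u) \<longrightarrow> T q = T u)"
    using cu T_dist u T_eq by (simp del: mult_Suc)
  also have "\<dots> \<longleftrightarrow> (\<forall>v\<in>P. d (T u) v \<le> 2 * (Suc t * r) \<longrightarrow> c v = c (T u) \<longrightarrow> v = T u)"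
    using T_surj T_in by metis
  finally show "u \<in> isolated P d r t c' \<longleftrightarrow> T u \<in> isolated P d r t c"
    using u T_in by (simp add: isolated_def)
qed

lemma strata_agree:
  assumes p: "p \<in> P" and m: "\<And>q. q \<in> P \<Longrightarrow> c q < m"
    and c: "\<And>q. q \<in> P \<Longrightarrow> d p q \<le> R + 2 * (Suc t * r) * (1 + Suc m * j) \<Longrightarrow> c' q = c (T q)"
  shows "agree p R (strata P d r t D c' j) (strata P d r t D c j)"
  using c
proof (induction j arbitrary: R)
  case 0
  then show ?case using isolated_agree[OF p] by simp
next
  case (Suc j)
  have e: "R + 2 * (Suc t * r) * (1 + Suc m * Suc j) =
      R + 2 * (Suc t * r) * Suc m + 2 * (Suc t * r) * (1 + Suc m * j)" by (simp add: algebra_simps)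
  have ag: "agree p (R + 2 * (Suc t * r) * Suc m) (strata P d r t D c' j) (strata P d r t D c j)"
    using Suc.prems unfolding e by (intro Suc.IH) auto
  have sub: "strata P d r t D c j \<subseteq> P" for c using strata_sub by (fastforce simp: isolated_def)
  show ?case unfolding strata.simps
  proof (rule rims_agree[OF sub sub p m ag])
    fix q assume q: "q \<in> P" "d p q \<le> R + 2 * (Suc t * r) * Suc m"
    then show "c' q = c (T q)" using Suc.prems[OF q(1)] unfolding e by (meson le_add1 le_trans)
  qed
qed

lemma piece_agree:
  assumes p: "p \<in> P" and m: "\<And>q. q \<in> P \<Longrightarrow> c q < m" and j: "j \<le> k"
    and c: "\<And>q. q \<in> P \<Longrightarrow> d p q \<le> 2 * (Suc t * r) * (1 + Suc m * k) \<Longrightarrow> c' q = c (T q)"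
  shows "p \<in> piece P d r t D c' k j \<longleftrightarrow> T p \<in> piece P d r t D c k j"
proof -
  have ag: "agree p 0 (strata P d r t D c' i) (strata P d r t D c i)" if "i \<le> k" for i
  proof (rule strata_agree[OF p m])
    fix q assume q: "q \<in> P" "d p q \<le> 0 + 2 * (Suc t * r) * (1 + Suc m * i)"
    have "2 * (Suc t * r) * (1 + Suc m * i) \<le> 2 * (Suc t * r) * (1 + Suc m * k)"
      using that by (intro mult_le_mono2 add_left_mono) simp
    then show "c' q = c (T q)" using c q by (simp only: add_0)
  qed
  have "p \<in> strata P d r t D c' i \<longleftrightarrow> T p \<in> strata P d r t D c i" if "i \<le> k" for i
    using ag[OF that] p dist_eq_0[OF p p] by (simp add: agree_def)
  then show ?thesis by (auto simp: piece_def simp del: strata.simps)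
qed

end

end




section \<open>The action of exponent vectors\<close>

text \<open>Exponent vectors and displacements are functions of which only the coordinates \<open>1, \<dots>, k\<close>
matter.\<close>

type_synonym vec = "nat \<Rightarrow> int"

definition box :: "nat \<Rightarrow> nat \<Rightarrow> vec set" where
  "box k n = {v. \<forall>j\<in>{1..k}. \<bar>v j\<bar> \<le> int n}"

definition cone :: "nat \<Rightarrow> vec set" where
  "cone k = {v. \<forall>j\<in>{1..k}. 0 \<le> v j}"

definition diag :: "nat \<Rightarrow> vec" where
  "diag n = (\<lambda>_. int n)"

lemma box_add: "v \<in> box k m \<Longrightarrow> w \<in> box k n \<Longrightarrow> v + w \<in> box k (m + n)"
  unfolding box_def plus_fun_def by fastforce

lemma box_uminus: "v \<in> box k m \<Longrightarrow> - v \<in> box k m"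
  by (auto simp: box_def)

lemma box_diff: "v \<in> box k m \<Longrightarrow> w \<in> box k n \<Longrightarrow> v - w \<in> box k (m + n)"
  using box_add[of v k m "- w" n] box_uminus by auto

lemma box_mono: "m \<le> n \<Longrightarrow> v \<in> box k m \<Longrightarrow> v \<in> box k n"
  unfolding box_def by fastforce

lemma box_zero: "0 \<in> box k n"
  by (simp add: box_def)

lemma box_ex: "\<exists>n. v \<in> box k n"
proof -
  have "\<bar>v j\<bar> \<le> int (\<Sum>i\<in>{1..k}. nat \<bar>v i\<bar>)" if "j \<in> {1..k}" for j
  proof -
    have "nat \<bar>v j\<bar> \<le> (\<Sum>i\<in>{1..k}. nat \<bar>v i\<bar>)" using that by (intro member_le_sum) auto
    then show ?thesis by linarith
  qed
  then show ?thesis unfolding box_def by blast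
qed

lemma cone_add: "v \<in> cone k \<Longrightarrow> w \<in> cone k \<Longrightarrow> v + w \<in> cone k"
  by (auto simp: cone_def)

lemma diag_cone: "v \<in> box k n \<Longrightarrow> n \<le> m \<Longrightarrow> diag m + v \<in> cone k"
  unfolding box_def cone_def diag_def by fastforce

lemma diag_cone_minus: "v \<in> box k n \<Longrightarrow> n \<le> m \<Longrightarrow> diag m - v \<in> cone k"
  unfolding box_def cone_def diag_def by fastforce

lemma diag_in_cone: "diag m \<in> cone k"
  by (simp add: diag_def cone_def)

lemma diag_in_box: "diag m \<in> box k m"
  by (simp add: diag_def box_def)

lemma diag_add: "diag (m + n) = diag m + diag n"
  by (auto simp: diag_def)

lemma diag_diff: "n \<le> m \<Longrightarrow> diag (m - n) = diag m - diag n"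
  by (auto simp: diag_def)

primrec act :: "(nat \<Rightarrow> 'a \<Rightarrow> 'a) \<Rightarrow> nat \<Rightarrow> vec \<Rightarrow> 'a \<Rightarrow> 'a" where
  "act f 0 a x = x"
| "act f (Suc k) a x = (f (Suc k) ^^ nat (a (Suc k))) (act f k a x)"

text \<open>Distance in the graph up to a factor \<open>2k\<close>, but independent of the carrier: it is the same for a
system and for a forward closed subsystem.\<close>

definition near :: "(nat \<Rightarrow> 'a \<Rightarrow> 'a) \<Rightarrow> nat \<Rightarrow> nat \<Rightarrow> 'a \<Rightarrow> 'a \<Rightarrow> bool" where
  "near f k n x y \<longleftrightarrow> (\<exists>a\<in>cone k \<inter> box k n. \<exists>b\<in>cone k \<inter> box k n. act f k a x = act f k b y)"

lemma act_cong: "(\<And>j. j \<in> {1..k} \<Longrightarrow> a j = b j) \<Longrightarrow> act f k a x = act f k b x"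
  by (induction k) auto

lemma act_zero: "act f k 0 x = x"
  by (induction k) auto

lemma commuting_maps_less: "commuting_maps X (Suc k) K f \<Longrightarrow> commuting_maps X k K f"
  by (auto simp: commuting_maps_def)

lemma iterate_closed:
  assumes "commuting_maps X k K f" "j \<in> {1..k}" "x \<in> X"
  shows "(f j ^^ n) x \<in> X"
  using assms by (induction n) (auto simp: commuting_maps_def)

lemma act_closed: "commuting_maps X k K f \<Longrightarrow> x \<in> X \<Longrightarrow> act f k a x \<in> X"
proof (induction k)
  case (Suc k)
  have "act f k a x \<in> X" by (rule Suc.IH[OF commuting_maps_less[OF Suc.prems(1)] Suc.prems(2)])
  then show ?case using iterate_closed[OF Suc.prems(1)] by simp
qed simp

lemma iterate_commute:
  assumes "commuting_maps X k K f" "i \<in> {1..k}" "j \<in> {1..k}" "x \<in> X"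
  shows "(f i ^^ m) ((f j ^^ n) x) = (f j ^^ n) ((f i ^^ m) x)"
proof -
  have 1: "f i ((f j ^^ n) x) = (f j ^^ n) (f i x)" if "x \<in> X" for x n
    using that
  proof (induction n)
    case (Suc n)
    have "(f j ^^ n) x \<in> X" by (rule iterate_closed[OF assms(1,3) Suc.prems])
    then have "f i (f j ((f j ^^ n) x)) = f j (f i ((f j ^^ n) x))"
      using assms(1-3) by (auto simp: commuting_maps_def)
    then show ?case using Suc by simp
  qed simp
  show ?thesis using assms(4)
  proof (induction m)
    case (Suc m)
    have "(f i ^^ m) x \<in> X" by (rule iterate_closed[OF assms(1,2) Suc.prems])
    then show ?case using Suc 1[of "(f i ^^ m) x"] by simp
  qed simp
qed

lemma act_iterate:
  assumes "commuting_maps X k K f" "l \<le> k" "j \<in> {1..k}" "x \<in> X"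
  shows "act f l a ((f j ^^ n) x) = (f j ^^ n) (act f l a x)"
  using assms(2)
proof (induction l)
  case (Suc l)
  have "commuting_maps X l K f" using assms(1) Suc.prems unfolding commuting_maps_def by auto
  then have "act f l a x \<in> X" by (rule act_closed[OF _ assms(4)])
  then have "(f (Suc l) ^^ nat (a (Suc l))) ((f j ^^ n) (act f l a x)) =
      (f j ^^ n) ((f (Suc l) ^^ nat (a (Suc l))) (act f l a x))"
    using Suc.prems by (intro iterate_commute[OF assms(1) _ assms(3)]) auto
  then show ?case using Suc by simp
qed simp

lemma act_add:
  assumes "commuting_maps X k K f" "a \<in> cone k" "b \<in> cone k" "x \<in> X"
  shows "act f k (a + b) x = act f k a (act f k b x)"
  using assms
proof (induction k)
  case (Suc k)
  have cm: "commuting_maps X k K f" using Suc.prems commuting_maps_less by blast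
  have "a \<in> cone k" "b \<in> cone k" using Suc.prems by (auto simp: cone_def)
  then have IH: "act f k (a + b) x = act f k a (act f k b x)" by (intro Suc.IH[OF cm _ _ Suc.prems(4)])
  have "0 \<le> a (Suc k)" "0 \<le> b (Suc k)" using Suc.prems by (auto simp: cone_def)
  then have n: "nat ((a + b) (Suc k)) = nat (a (Suc k)) + nat (b (Suc k))" by (simp add: nat_add_distrib)
  have "act f k b x \<in> X" by (rule act_closed[OF cm Suc.prems(4)])
  then have "act f k a ((f (Suc k) ^^ nat (b (Suc k))) (act f k b x)) =
      (f (Suc k) ^^ nat (b (Suc k))) (act f k a (act f k b x))"
    by (intro act_iterate[OF Suc.prems(1)]) auto
  then show ?case unfolding act.simps(2) IH n funpow_add by simp
qed simp

lemma act_commute: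
  assumes "commuting_maps X k K f" "a \<in> cone k" "b \<in> cone k" "x \<in> X"
  shows "act f k a (act f k b x) = act f k b (act f k a x)"
  using act_add[OF assms] act_add[OF assms(1,3,2,4)] by (simp add: add.commute)

lemma nearness_near: "commuting_maps X k K f \<Longrightarrow> nearness (near f k) X"
proof
  assume cm: "commuting_maps X k K f"
  show "near f k n x x" for n x
    unfolding near_def by (intro bexI[of _ 0]) (auto simp: cone_def box_def)
  show "near f k n x y" if "m \<le> n" "near f k m x y" for m n x y
    using that box_mono unfolding near_def by blast
  show "near f k (m + n) x z" if X: "x \<in> X" "y \<in> X" "z \<in> X" and "near f k m x y" "near f k n y z" for m n x y z
  proof -
    obtain a b where ab: "a \<in> cone k \<inter> box k m" "b \<in> cone k \<inter> box k m" "act f k a x = act f k b y"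
      using \<open>near f k m x y\<close> unfolding near_def by blast
    obtain c d where cd: "c \<in> cone k \<inter> box k n" "d \<in> cone k \<inter> box k n" "act f k c y = act f k d z"
      using \<open>near f k n y z\<close> unfolding near_def by blast
    have "act f k (a + c) x = act f k c (act f k a x)"
      using act_add[OF cm, of c a x] ab cd X by (simp add: add.commute)
    also have "\<dots> = act f k b (act f k c y)" using ab cd X act_commute[OF cm] by auto
    also have "\<dots> = act f k (b + d) z" using ab cd X act_add[OF cm, of b d z] by auto
    finally show ?thesis unfolding near_def
      using ab cd cone_add box_add by (intro bexI[of _ "a + c"] bexI[of _ "b + d"]) auto
  qed
qed

lemma iterate_fibre:
  assumes cm: "commuting_maps X k K f" and j: "j \<in> {1..k}" and y: "y \<in> X"
  shows "finite {x \<in> X. (f j ^^ n) x = y} \<and> card {x \<in> X. (f j ^^ n) x = y} \<le> K ^ n"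
  using y
proof (induction n arbitrary: y)
  case 0
  have "{x \<in> X. x = y} = {y}" using 0 by auto
  then show ?case by simp
next
  case (Suc n)
  have fib: "finite {z \<in> X. f j z = y}" "card {z \<in> X. f j z = y} \<le> K"
    using cm j Suc.prems by (auto simp: commuting_maps_def)
  have e: "{x \<in> X. (f j ^^ Suc n) x = y} = (\<Union>z\<in>{z \<in> X. f j z = y}. {x \<in> X. (f j ^^ n) x = z})"
    using iterate_closed[OF cm j] by auto
  have "card {x \<in> X. (f j ^^ Suc n) x = y} \<le> (\<Sum>z\<in>{z \<in> X. f j z = y}. card {x \<in> X. (f j ^^ n) x = z})"
    unfolding e by (rule card_UN_le[OF fib(1)])
  also have "\<dots> \<le> (\<Sum>z\<in>{z \<in> X. f j z = y}. K ^ n)" using Suc.IH by (intro sum_mono) auto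
  also have "\<dots> \<le> K * K ^ n" using fib(2) by simp
  finally show ?case unfolding e using fib Suc.IH by auto
qed

lemma act_fibre:
  assumes cm: "commuting_maps X k K f" and K: "K \<ge> 1" and a: "a \<in> box k n" and y: "y \<in> X"
  shows "finite {x \<in> X. act f k a x = y} \<and> card {x \<in> X. act f k a x = y} \<le> K ^ (n * k)"
  using cm a y
proof (induction k arbitrary: y)
  case 0
  have "{x \<in> X. x = y} = {y}" using 0 by auto
  then show ?case by simp
next
  case (Suc k)
  let ?n = "nat (a (Suc k))"
  have cm': "commuting_maps X k K f" using Suc.prems commuting_maps_less by blast
  have a': "a \<in> box k n" using Suc.prems by (auto simp: box_def)
  have "\<bar>a (Suc k)\<bar> \<le> int n" using Suc.prems by (auto simp: box_def)
  then have n: "?n \<le> n" by linarith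
  let ?Z = "{z \<in> X. (f (Suc k) ^^ ?n) z = y}"
  have fib: "finite ?Z" "card ?Z \<le> K ^ ?n" using iterate_fibre[OF Suc.prems(1)] Suc.prems(3) by auto
  have e: "{x \<in> X. act f (Suc k) a x = y} = (\<Union>z\<in>?Z. {x \<in> X. act f k a x = z})"
    using act_closed[OF cm'] by auto
  have "card {x \<in> X. act f (Suc k) a x = y} \<le> (\<Sum>z\<in>?Z. card {x \<in> X. act f k a x = z})"
    unfolding e by (rule card_UN_le[OF fib(1)])
  also have "\<dots> \<le> (\<Sum>z\<in>?Z. K ^ (n * k))" using Suc.IH[OF cm' a'] by (intro sum_mono) auto
  also have "\<dots> = card ?Z * K ^ (n * k)" by simp
  also have "\<dots> \<le> K ^ n * K ^ (n * k)"
    using fib(2) power_increasing[OF n K] by (intro mult_le_mono1) linarith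
  also have "\<dots> = K ^ (n * Suc k)" by (simp add: power_add)
  finally show ?case unfolding e using fib(1) Suc.IH[OF cm' a'] by auto
qed

section \<open>A proper colouring with boundedly many colours\<close>

text \<open>Each vertex is coloured after all smaller ones and avoids the at most \<open>m\<close> colours of its neighbours.\<close>

lemma greedy_colouring:
  fixes G :: "nat \<Rightarrow> nat \<Rightarrow> bool"
  assumes sym: "\<And>x y. G x y \<Longrightarrow> G y x" and irrefl: "\<And>x. \<not> G x x"
    and deg: "\<And>x. finite {y. G x y} \<and> card {y. G x y} \<le> m"
  shows "\<exists>c. \<forall>x. c x \<le> m \<and> (\<forall>y. G x y \<longrightarrow> c x \<noteq> c y)"
proof -
  have "\<exists>c. \<forall>x. (\<lambda>c x n. n \<le> m \<and> (\<forall>y<x. G x y \<longrightarrow> n \<noteq> c y)) c x (c x)"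
  proof (rule dependent_wf_choice[OF wf_less])
    fix c :: "nat \<Rightarrow> nat" and x
    have fin: "finite {y. G x y}" and "card {y. G x y} \<le> m" using deg by auto
    then have "card (c ` {y. G x y}) < card {..m}" using card_image_le[OF fin, of c] by simp
    then have "\<not> {..m} \<subseteq> c ` {y. G x y}"
      using card_mono[OF finite_imageI[OF fin], of "{..m}" c] by (metis not_le)
    then show "\<exists>n\<le>m. \<forall>y<x. G x y \<longrightarrow> n \<noteq> c y" by auto
  qed auto
  then obtain c where c: "\<And>x. c x \<le> m" "\<And>x y. y < x \<Longrightarrow> G x y \<Longrightarrow> c x \<noteq> c y" by auto
  have "c x \<noteq> c y" if "G x y" for x y
    using c(2)[of x y] c(2)[of y x] sym that irrefl by (metis linorder_neqE_nat)
  then show ?thesis using c(1) by blast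
qed

text \<open>The vectors in a box that vanish outside the relevant coordinates, in order to have a finite set.\<close>

definition supported_box :: "nat \<Rightarrow> nat \<Rightarrow> vec set" where
  "supported_box k n = {v \<in> box k n. \<forall>j. j \<notin> {1..k} \<longrightarrow> v j = 0}"

definition truncate :: "nat \<Rightarrow> vec \<Rightarrow> vec" where
  "truncate k v = (\<lambda>j. if j \<in> {1..k} then v j else 0)"

lemma finite_supported_box: "finite (supported_box k n)" and card_supported_box: "card (supported_box k n) \<le> (2 * n + 1) ^ k"
proof -
  have sub: "supported_box k n \<subseteq> truncate k ` (Pi\<^sub>E {1..k} (\<lambda>_. {- int n..int n}))"
  proof
    fix v assume v: "v \<in> supported_box k n"
    have "v = truncate k (restrict v {1..k})" using v by (auto simp: truncate_def supported_box_def)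
    moreover have "restrict v {1..k} \<in> Pi\<^sub>E {1..k} (\<lambda>_. {- int n..int n})"
      using v unfolding supported_box_def box_def by (auto simp: abs_le_iff)
    ultimately show "v \<in> truncate k ` (Pi\<^sub>E {1..k} (\<lambda>_. {- int n..int n}))" by blast
  qed
  have fin: "finite (Pi\<^sub>E {1..k} (\<lambda>_. {- int n..int n}))" by (intro finite_PiE) auto
  show "finite (supported_box k n)" using finite_subset[OF sub] fin by auto
  have "nat (2 * int n + 1) = 2 * n + 1" by linarith
  then have "card (Pi\<^sub>E {1..k} (\<lambda>_. {- int n..int n})) = (2 * n + 1) ^ k" by (simp add: card_PiE)
  then show "card (supported_box k n) \<le> (2 * n + 1) ^ k"
    using card_mono[OF finite_imageI[OF fin] sub] card_image_le[OF fin, of "truncate k"] by linarith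
qed

lemma truncate_box: "v \<in> box k n \<Longrightarrow> truncate k v \<in> supported_box k n"
  by (auto simp: truncate_def supported_box_def box_def)

text \<open>Two points are to be distinguished if both are images of one point under short vectors. By the bound on the
fibres, a point has boundedly many such partners: boundedly many ancestors, each with boundedly many images.\<close>

lemma ancestor_colouring:
  fixes X :: "nat set"
  assumes cm: "commuting_maps X k K f" and K: "K \<ge> 1"
  shows "\<exists>c. (\<forall>x. c x < (2 * n + 1) ^ k * K ^ (n * k) * (2 * n + 1) ^ k + 1) \<and>
    (\<forall>y\<in>X. \<forall>a\<in>cone k \<inter> box k n. \<forall>b\<in>cone k \<inter> box k n.
       c (act f k a y) = c (act f k b y) \<longrightarrow> act f k a y = act f k b y)"
proof -
  define B where "B = supported_box k n"
  have B: "finite B" "card B \<le> (2 * n + 1) ^ k" using finite_supported_box card_supported_box by (auto simp: B_def)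
  define G where "G w w' \<longleftrightarrow> w \<noteq> w' \<and> (\<exists>y\<in>X. \<exists>a\<in>B. \<exists>b\<in>B. w = act f k a y \<and> w' = act f k b y)" for w w'
  let ?m = "(2 * n + 1) ^ k * K ^ (n * k) * (2 * n + 1) ^ k"
  have deg: "finite {w'. G w w'} \<and> card {w'. G w w'} \<le> ?m" for w
  proof (cases "w \<in> X")
    case False
    then have "{w'. G w w'} = {}" using act_closed[OF cm] by (auto simp: G_def)
    then show ?thesis by simp
  next
    case True
    define Y where "Y = (\<Union>a\<in>B. {x \<in> X. act f k a x = w})"
    have "finite {x \<in> X. act f k a x = w} \<and> card {x \<in> X. act f k a x = w} \<le> K ^ (n * k)" if "a \<in> B" for a
      using that by (intro act_fibre[OF cm K _ True]) (simp add: B_def supported_box_def)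
    then have Y: "finite Y" "card Y \<le> card B * K ^ (n * k)"
      using card_UN_le[OF B(1), of "\<lambda>a. {x \<in> X. act f k a x = w}"]
        sum_bounded_above[of B "\<lambda>a. card {x \<in> X. act f k a x = w}" "K ^ (n * k)"] B(1)
      by (auto simp: Y_def intro: order_trans)
    have sub: "{w'. G w w'} \<subseteq> (\<lambda>(y, b). act f k b y) ` (Y \<times> B)"
    proof
      fix w' assume "w' \<in> {w'. G w w'}"
      then obtain y a b where "y \<in> X" "a \<in> B" "b \<in> B" "w = act f k a y" "w' = act f k b y"
        by (auto simp: G_def)
      then show "w' \<in> (\<lambda>(y, b). act f k b y) ` (Y \<times> B)"
        by (intro image_eqI[of _ _ "(y, b)"]) (auto simp: Y_def)
    qed
    have fin: "finite (Y \<times> B)" using Y B by simp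
    have "card {w'. G w w'} \<le> card (Y \<times> B)"
      using card_mono[OF finite_imageI[OF fin] sub] card_image_le[OF fin, of "\<lambda>(y, b). act f k b y"] by linarith
    also have "\<dots> \<le> (card B * K ^ (n * k)) * card B" using Y by (simp add: card_cartesian_product)
    also have "\<dots> \<le> ?m" using B(2) by (intro mult_le_mono) auto
    finally show ?thesis using finite_subset[OF sub finite_imageI[OF fin]] by blast
  qed
  have "\<exists>c. \<forall>x. c x \<le> ?m \<and> (\<forall>y. G x y \<longrightarrow> c x \<noteq> c y)"
    using deg by (intro greedy_colouring) (auto simp: G_def)
  then obtain c where c: "\<And>x. c x \<le> ?m" "\<And>x y. G x y \<Longrightarrow> c x \<noteq> c y" by blast
  have "act f k a y = act f k b y"
    if "y \<in> X" "a \<in> box k n" "b \<in> box k n" "c (act f k a y) = c (act f k b y)" for y a b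
  proof -
    have "act f k a y = act f k (truncate k a) y" "act f k b y = act f k (truncate k b) y"
      by (auto intro: act_cong simp: truncate_def)
    moreover have "truncate k a \<in> B" "truncate k b \<in> B" using that truncate_box by (auto simp: B_def)
    ultimately show ?thesis using c(2) that unfolding G_def by metis
  qed
  then show ?thesis using c(1) by (intro exI[of _ c]) (auto simp: less_Suc_eq_le)
qed




section \<open>Subgroups of the integer lattice\<close>

text \<open>Subgroups of \<open>\<int>\<^sup>k\<close>; containing all vectors without relevant coordinates makes the irrelevant
coordinates invisible in the quotient.\<close>

definition lattice_in :: "nat \<Rightarrow> vec set \<Rightarrow> bool" where
  "lattice_in k L \<longleftrightarrow> {v. \<forall>j\<in>{1..k}. v j = 0} \<subseteq> L \<and> (\<forall>v\<in>L. \<forall>w\<in>L. v - w \<in> L)"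

lemma lattice_zero: "lattice_in k L \<Longrightarrow> 0 \<in> L"
  by (auto simp: lattice_in_def)

lemma lattice_diff: "lattice_in k L \<Longrightarrow> v \<in> L \<Longrightarrow> w \<in> L \<Longrightarrow> v - w \<in> L"
  by (auto simp: lattice_in_def)

lemma lattice_uminus: "lattice_in k L \<Longrightarrow> v \<in> L \<Longrightarrow> - v \<in> L"
  using lattice_diff[of k L 0 v] lattice_zero by auto

lemma lattice_add: "lattice_in k L \<Longrightarrow> v \<in> L \<Longrightarrow> w \<in> L \<Longrightarrow> v + w \<in> L"
  using lattice_diff[of k L v "- w"] lattice_uminus by auto

lemma lattice_vanish: "lattice_in k L \<Longrightarrow> (\<And>j. j \<in> {1..k} \<Longrightarrow> v j = 0) \<Longrightarrow> v \<in> L"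
  by (auto simp: lattice_in_def)

lemma lattice_truncate: "lattice_in k L \<Longrightarrow> truncate k v \<in> L \<longleftrightarrow> v \<in> L"
proof -
  assume L: "lattice_in k L"
  have z: "v - truncate k v \<in> L" by (rule lattice_vanish[OF L]) (simp add: truncate_def)
  show ?thesis using lattice_add[OF L _ z, of "truncate k v"] lattice_diff[OF L _ z, of v] by auto
qed

lemma int_subgroup_mult:
  fixes I :: "int set"
  assumes I: "\<And>a b. a \<in> I \<Longrightarrow> b \<in> I \<Longrightarrow> a - b \<in> I" and d: "d \<in> I"
  shows "z * d \<in> I"
proof (induction z rule: int_induct[of _ 0])
  case base
  show ?case using I[OF d d] by simp
next
  case (step1 i)
  have "- d \<in> I" using I[OF I[OF d d] d] by simp
  then show ?case using I[OF step1(2), of "- d"] by (simp add: algebra_simps)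
next
  case (step2 i)
  then show ?case using I[OF step2(2) d] by (simp add: algebra_simps)
qed

lemma int_subgroup_principal:
  fixes I :: "int set"
  assumes I: "\<And>a b. a \<in> I \<Longrightarrow> b \<in> I \<Longrightarrow> a - b \<in> I" and ne: "I \<noteq> {}"
  shows "\<exists>d\<in>I. \<forall>a\<in>I. d dvd a"
proof (cases "I \<subseteq> {0}")
  case True
  then show ?thesis using ne by auto
next
  case False
  then obtain a where a: "a \<in> I" "a \<noteq> 0" by auto
  have zero: "0 \<in> I" using I[OF a(1) a(1)] by simp
  have "\<bar>a\<bar> \<in> I" using a I[OF zero a(1)] by (auto simp: abs_if)
  then have ex: "\<exists>n. 0 < n \<and> int n \<in> I" using a by (intro exI[of _ "nat \<bar>a\<bar>"]) auto
  define n where "n = (LEAST n. 0 < n \<and> int n \<in> I)"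
  have n: "0 < n" "int n \<in> I" using LeastI_ex[OF ex] by (auto simp: n_def)
  have "int n dvd b" if b: "b \<in> I" for b
  proof -
    have "b mod int n = b - b div int n * int n" by (simp add: minus_div_mult_eq_mod)
    then have mem: "b mod int n \<in> I" using I[OF b int_subgroup_mult[OF I n(2)]] by simp
    have bd: "0 \<le> b mod int n" "b mod int n < int n" using n by simp_all
    have "\<not> 0 < nat (b mod int n)"
      using not_less_Least[of "nat (b mod int n)" "\<lambda>n. 0 < n \<and> int n \<in> I"] mem bd
      by (auto simp: n_def[symmetric])
    then show ?thesis using bd by auto
  qed
  then show ?thesis using n by blast
qed

lemma int_subgroups_stabilise:
  fixes I :: "nat \<Rightarrow> int set"
  assumes I: "\<And>n a b. a \<in> I n \<Longrightarrow> b \<in> I n \<Longrightarrow> a - b \<in> I n" and zero: "\<And>n. 0 \<in> I n"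
    and mono: "\<And>m n. m \<le> n \<Longrightarrow> I m \<subseteq> I n"
  shows "\<exists>m. \<forall>n. I n \<subseteq> I m"
proof -
  have "\<exists>d\<in>(\<Union>n. I n). \<forall>a\<in>(\<Union>n. I n). d dvd a"
  proof (rule int_subgroup_principal)
    fix a b assume "a \<in> (\<Union>n. I n)" "b \<in> (\<Union>n. I n)"
    then obtain m n where "a \<in> I m" "b \<in> I n" by blast
    then have "a \<in> I (max m n)" "b \<in> I (max m n)"
      using mono[of m "max m n"] mono[of n "max m n"] by auto
    then show "a - b \<in> (\<Union>n. I n)" using I by blast
  qed (use zero in blast)
  then obtain d m where d: "d \<in> I m" "\<And>a n. a \<in> I n \<Longrightarrow> d dvd a" by blast
  have "I n \<subseteq> I m" for n
  proof
    fix a assume "a \<in> I n"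
    then obtain z where "a = z * d" using d(2) by (metis dvdE mult.commute)
    then show "a \<in> I m" using int_subgroup_mult[OF I d(1)] by simp
  qed
  then show ?thesis by blast
qed

text \<open>The entries in position \<open>j\<close> of the elements in echelon form. These subgroups of \<open>\<int>\<close> detect strict
inclusion of lattices.\<close>

definition leading :: "nat \<Rightarrow> vec set \<Rightarrow> int set" where
  "leading j L = (\<lambda>v. v j) ` {v \<in> L. \<forall>i\<in>{1..<j}. v i = 0}"

text \<open>Gaussian elimination: the coordinates of \<open>v\<close> are cleared one after the other by elements of \<open>L\<close>.\<close>

lemma leading_eq_imp_subset:
  assumes L: "lattice_in k L" "lattice_in k L'" "L \<subseteq> L'"
    and lead: "\<And>j. j \<in> {1..k} \<Longrightarrow> leading j L' \<subseteq> leading j L"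
  shows "L' \<subseteq> L"
proof
  fix v assume v: "v \<in> L'"
  have "i \<le> k \<Longrightarrow> \<exists>w\<in>L. \<forall>j\<in>{1..i}. (v - w) j = 0" for i
  proof (induction i)
    case 0
    show ?case using lattice_zero[OF L(1)] by auto
  next
    case (Suc i)
    then obtain w where w: "w \<in> L" "\<forall>j\<in>{1..i}. (v - w) j = 0" by auto
    have "v - w \<in> L'" using lattice_diff[OF L(2) v] w L(3) by blast
    then have "(v - w) (Suc i) \<in> leading (Suc i) L'"
      unfolding leading_def using w by (intro image_eqI[of _ _ "v - w"]) auto
    then have "(v - w) (Suc i) \<in> leading (Suc i) L" using lead[of "Suc i"] Suc.prems by auto
    then obtain u where u: "u \<in> L" "\<forall>j\<in>{1..<Suc i}. u j = 0" "u (Suc i) = (v - w) (Suc i)"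
      unfolding leading_def by auto
    have "(v - (w + u)) j = 0" if "j \<in> {1..Suc i}" for j
      using w(2) u(2,3) that by (cases "j = Suc i") auto
    then show ?case using lattice_add[OF L(1) w(1) u(1)] by blast
  qed
  from this[OF le_refl] obtain w where w: "w \<in> L" "\<And>j. j \<in> {1..k} \<Longrightarrow> (v - w) j = 0" by blast
  have "v - w \<in> L" using lattice_vanish[OF L(1) w(2)] .
  then show "v \<in> L" using lattice_add[OF L(1) _ w(1)] by fastforce
qed

text \<open>In an ascending chain the subgroups \<open>leading j\<close>, for the finitely many \<open>j\<close>, all become stationary.\<close>

lemma wf_lattices: "wf {(L', L). lattice_in k L \<and> lattice_in k L' \<and> L \<subset> L'}"
  unfolding wf_iff_no_infinite_down_chain
proof
  assume "\<exists>L. \<forall>i. (L (Suc i), L i) \<in> {(L', L). lattice_in k L \<and> lattice_in k L' \<and> L \<subset> L'}"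
  then obtain L where "\<forall>i. (L (Suc i), L i) \<in> {(L', L). lattice_in k L \<and> lattice_in k L' \<and> L \<subset> L'}" ..
  then have L: "\<And>i. lattice_in k (L i)" "\<And>i. L i \<subset> L (Suc i)" by simp_all
  have mono: "L m \<subseteq> L n" if "m \<le> n" for m n
    using lift_Suc_mono_le[of L] L(2) that by blast
  have "\<exists>m. \<forall>n. leading j (L n) \<subseteq> leading j (L m)" for j
  proof (rule int_subgroups_stabilise)
    fix n a b assume "a \<in> leading j (L n)" "b \<in> leading j (L n)"
    then obtain v w where vw: "v \<in> L n" "w \<in> L n" "\<forall>i\<in>{1..<j}. v i = 0" "\<forall>i\<in>{1..<j}. w i = 0"
        "a = v j" "b = w j" by (auto simp: leading_def)
    then show "a - b \<in> leading j (L n)" unfolding leading_def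
      using lattice_diff[OF L(1) vw(1,2)] by (intro image_eqI[of _ _ "v - w"]) auto
  next
    show "0 \<in> leading j (L n)" for n
      unfolding leading_def using lattice_zero[OF L(1)] by (intro image_eqI[of _ _ 0]) auto
  qed (use mono in \<open>auto simp: leading_def\<close>)
  then obtain m where m: "\<And>j n. leading j (L n) \<subseteq> leading j (L (m j))" by metis
  define M where "M = Max (insert 0 (m ` {1..k}))"
  have "L (Suc M) \<subseteq> L M"
  proof (rule leading_eq_imp_subset[OF L(1) L(1)])
    show "leading j (L (Suc M)) \<subseteq> leading j (L M)" if "j \<in> {1..k}" for j
    proof -
      have "m j \<le> M" using that by (auto simp: M_def)
      then have "leading j (L (m j)) \<subseteq> leading j (L M)" using mono by (fastforce simp: leading_def)
      then show ?thesis using m by blast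
    qed
  qed (use L(2) in auto)
  then show False using L(2)[of M] by blast
qed

section \<open>The quotient group as a metric space\<close>

definition coset :: "vec set \<Rightarrow> vec \<Rightarrow> vec set" where
  "coset L v = {w. w - v \<in> L}"

definition cosets :: "vec set \<Rightarrow> vec set set" where
  "cosets L = range (coset L)"

text \<open>The quotient metric of the maximum norm.\<close>

definition cdist :: "nat \<Rightarrow> vec set \<Rightarrow> vec set \<Rightarrow> nat" where
  "cdist k A B = (LEAST n. \<exists>a\<in>A. \<exists>b\<in>B. a - b \<in> box k n)"

definition translate :: "vec \<Rightarrow> vec set \<Rightarrow> vec set" where
  "translate u A = (\<lambda>v. v + u) ` A"

definition rep :: "nat \<Rightarrow> vec set \<Rightarrow> vec set \<Rightarrow> vec" where
  "rep k L A = (SOME v. v \<in> A \<and> v \<in> box k (cdist k L A))"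

lemma coset_eq: "lattice_in k L \<Longrightarrow> coset L v = coset L w \<longleftrightarrow> v - w \<in> L"
proof -
  assume L: "lattice_in k L"
  have "coset L v \<subseteq> coset L w" if vw: "v - w \<in> L" for v w
  proof
    fix u assume "u \<in> coset L v"
    then have "(u - v) + (v - w) \<in> L" by (intro lattice_add[OF L _ vw]) (simp add: coset_def)
    then show "u \<in> coset L w" by (simp only: coset_def mem_Collect_eq diff_add_cancel add_diff_eq)
  qed
  moreover have "v - w \<in> L" if eq: "coset L v = coset L w"
  proof -
    have "v \<in> coset L v" using lattice_zero[OF L] by (simp add: coset_def)
    then show ?thesis unfolding eq by (simp add: coset_def)
  qed
  moreover have "w - v \<in> L" if "v - w \<in> L" using lattice_uminus[OF L that] by simp
  ultimately show ?thesis by blast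
qed

lemma coset_self: "lattice_in k L \<Longrightarrow> v \<in> coset L v"
  by (simp add: coset_def lattice_zero)

lemma coset_zero: "lattice_in k L \<Longrightarrow> coset L 0 = L"
  by (simp add: coset_def)

lemma in_cosets: "coset L v \<in> cosets L"
  by (simp add: cosets_def)

lemma lattice_in_cosets: "lattice_in k L \<Longrightarrow> L \<in> cosets L"
  using coset_zero in_cosets by metis

lemma coset_of:
  assumes L: "lattice_in k L" and A: "A \<in> cosets L" and v: "v \<in> A"
  shows "A = coset L v"
proof -
  obtain u where u: "A = coset L u" using A by (auto simp: cosets_def)
  have "v - u \<in> L" using v by (simp add: u coset_def)
  then have "coset L v = coset L u" using coset_eq[OF L] by blast
  then show ?thesis using u by simp
qed

lemma cdist_le:
  assumes "a \<in> A" "b \<in> B" "a - b \<in> box k n"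
  shows "cdist k A B \<le> n"
  unfolding cdist_def using assms by (intro Least_le) blast

lemma cdist_witness:
  assumes L: "lattice_in k L" and A: "A \<in> cosets L" "B \<in> cosets L" and n: "cdist k A B \<le> n" and b: "b \<in> B"
  shows "\<exists>a\<in>A. a - b \<in> box k n"
proof -
  obtain v w where vw: "v \<in> A" "w \<in> B" using A coset_self[OF L] by (auto simp: cosets_def)
  obtain m where "v - w \<in> box k m" using box_ex by blast
  then have "\<exists>n. \<exists>a\<in>A. \<exists>b\<in>B. a - b \<in> box k n" using vw by blast
  from LeastI_ex[OF this] obtain a c where ac: "a \<in> A" "c \<in> B" "a - c \<in> box k (cdist k A B)"
    unfolding cdist_def by blast
  have "b - c \<in> L" using coset_of[OF L A(2) ac(2)] b by (auto simp: coset_def)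
  then have "a + (b - c) \<in> A" using coset_of[OF L A(1) ac(1)] by (auto simp: coset_def)
  moreover have "a + (b - c) - b = a - c" by simp
  ultimately show ?thesis using box_mono[OF n ac(3)] by metis
qed

lemma rep:
  assumes L: "lattice_in k L" and A: "A \<in> cosets L"
  shows "rep k L A \<in> A" "rep k L A \<in> box k (cdist k L A)"
proof -
  have "cdist k A L \<le> cdist k L A"
  proof -
    obtain v where v: "v \<in> A" using A coset_self[OF L] by (auto simp: cosets_def)
    obtain l where l: "l \<in> L" "l - v \<in> box k (cdist k L A)"
      using cdist_witness[OF L lattice_in_cosets[OF L] A le_refl v] by blast
    then show ?thesis using box_uminus[OF l(2)] by (intro cdist_le[OF v l(1)]) simp
  qed
  then obtain v where "v \<in> A" "v - 0 \<in> box k (cdist k L A)"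
    using cdist_witness[OF L A lattice_in_cosets[OF L] _ lattice_zero[OF L]] by blast
  then have "\<exists>v. v \<in> A \<and> v \<in> box k (cdist k L A)" by auto
  from someI_ex[OF this] show "rep k L A \<in> A" "rep k L A \<in> box k (cdist k L A)"
    by (auto simp: rep_def)
qed

lemma translate_coset: "translate u (coset L v) = coset L (v + u)"
proof -
  have "w \<in> translate u (coset L v)" if "w - (v + u) \<in> L" for w
    unfolding translate_def using that by (intro image_eqI[of _ _ "w - u"]) (auto simp: coset_def algebra_simps)
  then show ?thesis by (auto simp: translate_def coset_def algebra_simps)
qed

lemma translate_bij: "bij_betw (translate u) (cosets L) (cosets L)"
proof (rule bij_betw_byWitness[where f' = "translate (- u)"])
qed (auto simp: cosets_def translate_coset)

lemma cosets_bounded_growth: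
  assumes L: "lattice_in k L"
  shows "bounded_growth (cosets L) (cdist k) (\<lambda>n. (2 * n + 1) ^ k)"
proof
  have sym: "cdist k A B \<le> cdist k B A" if AB: "A \<in> cosets L" "B \<in> cosets L" for A B
  proof -
    obtain a where a: "a \<in> A" using AB coset_self[OF L] by (auto simp: cosets_def)
    obtain b where b: "b \<in> B" "b - a \<in> box k (cdist k B A)"
      using cdist_witness[OF L AB(2,1) le_refl a] by blast
    then show ?thesis using box_uminus[OF b(2)] by (intro cdist_le[OF a b(1)]) simp
  qed
  then show comm: "cdist k A B = cdist k B A" if "A \<in> cosets L" "B \<in> cosets L" for A B
    using that by (simp add: le_antisym)
  show "cdist k A B = 0 \<longleftrightarrow> A = B" if AB: "A \<in> cosets L" "B \<in> cosets L" for A B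
  proof
    assume "A = B"
    moreover obtain a where "a \<in> A" using AB coset_self[OF L] by (auto simp: cosets_def)
    ultimately show "cdist k A B = 0" using cdist_le[of a A a B k 0] by (simp add: box_def)
  next
    assume d: "cdist k A B = 0"
    obtain b where b: "b \<in> B" using AB coset_self[OF L] by (auto simp: cosets_def)
    obtain a where a: "a \<in> A" "a - b \<in> box k 0"
      using cdist_witness[OF L AB _ b, of 0] d by auto
    have "a - b \<in> L" by (rule lattice_vanish[OF L]) (use a in \<open>auto simp: box_def\<close>)
    then show "A = B" using coset_of[OF L AB(1) a(1)] coset_of[OF L AB(2) b] coset_eq[OF L] by metis
  qed
  show "cdist k A C \<le> cdist k A B + cdist k B C"
    if AB: "A \<in> cosets L" "B \<in> cosets L" "C \<in> cosets L" for A B C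
  proof -
    obtain c where c: "c \<in> C" using AB coset_self[OF L] by (auto simp: cosets_def)
    obtain b where b: "b \<in> B" "b - c \<in> box k (cdist k B C)"
      using cdist_witness[OF L AB(2,3) le_refl c] by blast
    obtain a where a: "a \<in> A" "a - b \<in> box k (cdist k A B)"
      using cdist_witness[OF L AB(1,2) le_refl b(1)] by blast
    have "a - c = (a - b) + (b - c)" by simp
    then show ?thesis using box_add[OF a(2) b(2)] by (intro cdist_le[OF a(1) c]) simp
  qed
  show fin: "finite (ball_in (cdist k) (cosets L) A n)" and "card (ball_in (cdist k) (cosets L) A n) \<le> (2 * n + 1) ^ k"
    if A: "A \<in> cosets L" for A n
  proof -
    obtain a where a: "a \<in> A" using A coset_self[OF L] by (auto simp: cosets_def)
    have sub: "ball_in (cdist k) (cosets L) A n \<subseteq> (\<lambda>v. coset L (v + a)) ` supported_box k n"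
    proof
      fix B assume "B \<in> ball_in (cdist k) (cosets L) A n"
      then have B: "B \<in> cosets L" "cdist k B A \<le> n" using comm[OF _ A] by (auto simp: ball_in_def)
      obtain b where b: "b \<in> B" "b - a \<in> box k n" using cdist_witness[OF L B(1) A B(2) a] by blast
      have "b - (truncate k (b - a) + a) \<in> L" by (rule lattice_vanish[OF L]) (simp add: truncate_def)
      then have "B = coset L (truncate k (b - a) + a)" using coset_of[OF L B(1) b(1)] coset_eq[OF L] by simp
      then show "B \<in> (\<lambda>v. coset L (v + a)) ` supported_box k n" using truncate_box[OF b(2)] by blast
    qed
    show "finite (ball_in (cdist k) (cosets L) A n)"
      using finite_subset[OF sub] finite_supported_box by blast
    show "card (ball_in (cdist k) (cosets L) A n) \<le> (2 * n + 1) ^ k"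
      using card_mono[OF finite_imageI[OF finite_supported_box] sub] card_image_le[OF finite_supported_box]
        card_supported_box[of k n] by (meson le_trans)
  qed
qed

lemma translate_isometry:
  assumes L: "lattice_in k L" and A: "A \<in> cosets L" "B \<in> cosets L"
  shows "cdist k (translate u A) (translate u B) = cdist k A B"
proof -
  have "(\<exists>a\<in>translate u A. \<exists>b\<in>translate u B. a - b \<in> box k n) \<longleftrightarrow> (\<exists>a\<in>A. \<exists>b\<in>B. a - b \<in> box k n)" for n
    by (simp add: translate_def)
  then show ?thesis by (simp add: cdist_def)
qed

section \<open>Relations that hold from some height on\<close>

text \<open>The relation \<open>v\<close> is only required from height \<open>h\<close> on. Without the height, relations could not be
composed: \<open>v\<^sup>+ x = v\<^sup>- x\<close> and \<open>w\<^sup>+ x = w\<^sup>- x\<close> do not imply the reduced relation for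
\<open>v + w\<close>, since the maps need not be injective.\<close>

definition holds :: "(nat \<Rightarrow> 'a \<Rightarrow> 'a) \<Rightarrow> nat \<Rightarrow> 'a set \<Rightarrow> nat \<Rightarrow> vec \<Rightarrow> bool" where
  "holds f k X h v \<longleftrightarrow> v \<in> box k h \<and> (\<forall>x\<in>X. act f k (diag h + v) x = act f k (diag h) x)"

lemma holds_above:
  assumes cm: "commuting_maps X k K f" and h: "holds f k X h v" and b: "b - diag h \<in> cone k" and x: "x \<in> X"
  shows "act f k (b + v) x = act f k b x"
proof -
  have c: "diag h + v \<in> cone k" using h diag_cone by (auto simp: holds_def)
  have "act f k (b + v) x = act f k ((b - diag h) + (diag h + v)) x" by simp
  also have "\<dots> = act f k (b - diag h) (act f k (diag h) x)"
    using act_add[OF cm b c x] h x by (simp add: holds_def)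
  also have "\<dots> = act f k b x" using act_add[OF cm b diag_in_cone[of h] x] by simp
  finally show ?thesis .
qed

lemma holds_add:
  assumes cm: "commuting_maps X k K f" and v: "holds f k X h v" and w: "holds f k X i w"
  shows "holds f k X (h + i) (v + w)"
proof -
  have "act f k (diag (h + i) + (v + w)) x = act f k (diag (h + i)) x" if x: "x \<in> X" for x
  proof -
    have "(diag (h + i) + v) - diag i \<in> cone k"
      using diag_cone[of v k h h] v by (simp add: diag_add holds_def)
    then have "act f k ((diag (h + i) + v) + w) x = act f k (diag (h + i) + v) x"
      by (rule holds_above[OF cm w _ x])
    also have "\<dots> = act f k (diag (h + i)) x"
      by (rule holds_above[OF cm v _ x]) (simp add: diag_add diag_in_cone)
    finally show ?thesis by (simp add: add.assoc)
  qed
  then show ?thesis using v w box_add by (auto simp: holds_def)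
qed

lemma holds_uminus:
  assumes cm: "commuting_maps X k K f" and v: "holds f k X h v"
  shows "holds f k X (h + h) (- v)"
proof -
  have "act f k (diag (h + h) + - v) x = act f k (diag (h + h)) x" if x: "x \<in> X" for x
  proof -
    have "(diag (h + h) - v) - diag h \<in> cone k"
      using diag_cone_minus[of v k h h] v by (simp add: diag_add holds_def)
    from holds_above[OF cm v this x] show ?thesis by simp
  qed
  moreover have "- v \<in> box k (h + h)" using v box_uminus box_mono[of h "h + h"] by (auto simp: holds_def)
  ultimately show ?thesis by (auto simp: holds_def)
qed

lemma holds_zero: "holds f k X h 0"
  by (simp add: holds_def box_zero)

lemma holds_subset: "Y \<subseteq> X \<Longrightarrow> holds f k X h v \<Longrightarrow> holds f k Y h v"
  by (auto simp: holds_def)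

text \<open>Only finitely many elements of a lattice lie in a box, up to irrelevant coordinates.\<close>

lemma uniform_height:
  assumes L: "lattice_in k L"
  shows "\<exists>h. \<forall>X f b v x. commuting_maps X k K f \<longrightarrow> (\<forall>v\<in>L. holds f k X (\<eta> v) v) \<longrightarrow> v \<in> L \<longrightarrow>
    v \<in> box k B \<longrightarrow> b - diag h \<in> cone k \<longrightarrow> x \<in> X \<longrightarrow> act f k (b + v) x = act f k b x"
proof (intro exI[of _ "Max (insert 0 (\<eta> ` supported_box k B))"] allI impI)
  let ?h = "Max (insert 0 (\<eta> ` supported_box k B))"
  fix X f b v x
  assume cm: "commuting_maps X k K f" and hold: "\<forall>v\<in>L. holds f k X (\<eta> v) v" and v: "v \<in> L" "v \<in> box k B"
    and b: "b - diag ?h \<in> cone k" and x: "x \<in> X"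
  have c: "truncate k v \<in> supported_box k B" "truncate k v \<in> L" using truncate_box[OF v(2)] lattice_truncate[OF L] v(1) by auto
  have "\<eta> (truncate k v) \<le> ?h" using c finite_supported_box by (intro Max_ge) auto
  then have "b - diag (\<eta> (truncate k v)) \<in> cone k" using b by (force simp: cone_def diag_def)
  then have "act f k (b + truncate k v) x = act f k b x" using holds_above[OF cm _ _ x] hold c by blast
  moreover have "act f k (b + v) x = act f k (b + truncate k v) x" by (rule act_cong) (simp add: truncate_def)
  ultimately show "act f k (b + v) x = act f k b x" by simp
qed

text \<open>The points that satisfy one more relation form a subsystem to which a larger lattice applies. The new heights
\<open>\<eta>'\<close> do not depend on the system, which keeps the induction uniform over all systems.\<close>

lemma extend_lattice:
  assumes L: "lattice_in k L" and v: "v \<notin> L" "v \<in> box k H"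
  shows "\<exists>L' \<eta>'. lattice_in k L' \<and> L \<subset> L' \<and> (\<forall>(X :: 'a set) f. commuting_maps X k K f \<longrightarrow>
    (\<forall>w\<in>L. holds f k X (\<eta> w) w) \<longrightarrow>
    commuting_maps {x \<in> X. act f k (diag H + v) x = act f k (diag H) x} k K f \<and>
    (\<forall>w\<in>L'. holds f k {x \<in> X. act f k (diag H + v) x = act f k (diag H) x} (\<eta>' w) w))"
proof -
  let ?Y = "\<lambda>(X :: 'a set) f. {x \<in> X. act f k (diag H + v) x = act f k (diag H) x}"
  define L' where "L' = {w + (\<lambda>j. z * v j) | w z. w \<in> L}"
  have sub: "L \<subseteq> L'" unfolding L'_def by (fastforce intro: exI[of _ "0::int"])
  have "v \<in> L'" unfolding L'_def using lattice_zero[OF L] by (fastforce intro: exI[of _ "1::int"])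
  then have psub: "L \<subset> L'" using sub v by blast
  have lat: "lattice_in k L'"
    unfolding lattice_in_def
  proof (intro conjI ballI)
    show "{v. \<forall>j\<in>{1..k}. v j = 0} \<subseteq> L'" using L sub by (auto simp: lattice_in_def)
    fix a b assume "a \<in> L'" "b \<in> L'"
    then obtain w w' z z' where w: "w \<in> L" "w' \<in> L"
        and ab: "a = w + (\<lambda>j. z * v j)" "b = w' + (\<lambda>j. z' * v j)"
      unfolding L'_def by blast
    have "a - b = (w - w') + (\<lambda>j. (z - z') * v j)" by (auto simp: ab algebra_simps)
    then show "a - b \<in> L'" unfolding L'_def using lattice_diff[OF L w] by blast
  qed
  have cmY: "commuting_maps (?Y X f) k K f" if cm: "commuting_maps X k K f" for X f
  proof -
    have "f j x \<in> ?Y X f" if j: "j \<in> {1..k}" and x: "x \<in> ?Y X f" for j x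
    proof -
      have x': "x \<in> X" using x by simp
      have it: "act f k a (f j x) = f j (act f k a x)" for a
        using act_iterate[OF cm le_refl j x', of a 1] by simp
      have "f j x \<in> X" using cm j x' by (auto simp: commuting_maps_def)
      then show ?thesis using x by (simp add: it)
    qed
    moreover have "finite {x \<in> ?Y X f. f j x = y} \<and> card {x \<in> ?Y X f. f j x = y} \<le> K"
      if j: "j \<in> {1..k}" and y: "y \<in> ?Y X f" for j y
    proof -
      have X: "finite {x \<in> X. f j x = y}" "card {x \<in> X. f j x = y} \<le> K"
        using cm j y by (auto simp: commuting_maps_def)
      have sub: "{x \<in> ?Y X f. f j x = y} \<subseteq> {x \<in> X. f j x = y}" by auto
      show ?thesis using finite_subset[OF sub X(1)] card_mono[OF X(1) sub] X(2) by linarith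
    qed
    ultimately show ?thesis using cm unfolding commuting_maps_def by simp
  qed
  define Q where "Q w h \<longleftrightarrow> (\<forall>(X :: 'a set) f. commuting_maps X k K f \<longrightarrow>
    (\<forall>w\<in>L. holds f k X (\<eta> w) w) \<longrightarrow> holds f k (?Y X f) h w)" for w h
  have Qadd: "Q (w + w') (h + h')" if "Q w h" "Q w' h'" for w w' h h'
    using that holds_add[OF cmY] unfolding Q_def by blast
  have Qminus: "Q (- w) (h + h)" if "Q w h" for w h
    using that holds_uminus[OF cmY] unfolding Q_def by blast
  have QL: "Q w (\<eta> w)" if "w \<in> L" for w
    using that holds_subset[of "?Y _ _"] unfolding Q_def by (metis (no_types, lifting) mem_Collect_eq subsetI)
  have Qv: "Q v H" using v(2) unfolding Q_def holds_def by blast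
  have Qmult: "\<exists>h. Q (\<lambda>j. z * v j) h" for z
  proof (induction z rule: int_induct[of _ 0])
    case base
    have "Q 0 0" using holds_zero unfolding Q_def by blast
    moreover have "(\<lambda>j. 0 * v j) = (0 :: vec)" by auto
    ultimately show ?case by metis
  next
    case (step1 i)
    then obtain h where "Q (\<lambda>j. i * v j) h" by blast
    from Qadd[OF this Qv] have "Q ((\<lambda>j. i * v j) + v) (h + H)" .
    moreover have "(\<lambda>j. i * v j) + v = (\<lambda>j. (i + 1) * v j)" by (auto simp: algebra_simps)
    ultimately show ?case by auto
  next
    case (step2 i)
    then obtain h where "Q (\<lambda>j. i * v j) h" by blast
    from Qadd[OF this Qminus[OF Qv]] have "Q ((\<lambda>j. i * v j) + - v) (h + (H + H))" .
    moreover have "(\<lambda>j. i * v j) + - v = (\<lambda>j. (i - 1) * v j)" by (auto simp: algebra_simps)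
    ultimately show ?case by auto
  qed
  have "\<exists>h. Q w h" if "w \<in> L'" for w
    using that Qadd QL Qmult unfolding L'_def by blast
  then obtain \<eta>' where "\<And>w. w \<in> L' \<Longrightarrow> Q w (\<eta>' w)" by metis
  then have "\<forall>(X :: 'a set) f. commuting_maps X k K f \<longrightarrow> (\<forall>w\<in>L. holds f k X (\<eta> w) w) \<longrightarrow>
      commuting_maps (?Y X f) k K f \<and> (\<forall>w\<in>L'. holds f k (?Y X f) (\<eta>' w) w)"
    using cmY unfolding Q_def by blast
  then show ?thesis using lat psub by blast
qed




section \<open>Points without a further short relation\<close>

lemma cone_box_diff: "a \<in> cone k \<inter> box k n \<Longrightarrow> b \<in> cone k \<inter> box k n \<Longrightarrow> a - b \<in> box k n"
  unfolding cone_def box_def by fastforce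

lemma diag_minus_cone: "v \<in> box k n \<Longrightarrow> m + n \<le> h \<Longrightarrow> diag h + v - diag m \<in> cone k"
  unfolding box_def cone_def diag_def by fastforce

text \<open>The set \<open>G\<close> consists of the points at which region growing applies, that is, which see no other point
of their own colour nearby. A point outside of \<open>G\<close> sees its own colour at a displacement \<open>v \<notin> L\<close>, and then
properness of the colouring gives the relation \<open>(H + v) x = H x\<close>.\<close>

lemma free_points_coverable:
  fixes k K :: nat and L :: "vec set"
  assumes k: "k \<ge> 1" and K: "K \<ge> 1" and L: "lattice_in k L"
  shows "\<exists>D N H. N \<le> H \<and> (\<forall>(X :: nat set) f. commuting_maps X k K f \<longrightarrow> (\<forall>v\<in>L. holds f k X (\<eta> v) v) \<longrightarrow>
    (\<exists>G\<subseteq>X. coverable (near f k) G k r D \<and>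
      (\<forall>x\<in>X - G. \<exists>v\<in>supported_box k N - L. act f k (diag H + v) x = act f k (diag H) x)))"
proof -
  define r1 where "r1 = max r 1"
  have r1: "r1 \<ge> 1" "r \<le> r1" by (auto simp: r1_def)
  obtain t D where D: "D \<ge> 1" "t \<ge> 1" "D ^ t * (2 * (t * r1) + 1) ^ k < (D + 1) ^ t"
      "(2 * (t * r1 + 2 * ((t + 1) * r1) * k) + 1) ^ k < t * D ^ k"
    using growth_constants[OF k r1(1)] by blast
  have D': "(2 * (t * r1 + 2 * (Suc t * r1) * k) + 1) ^ k < t * D ^ k" using D(4) by simp
  interpret bounded_growth "cosets L" "cdist k" "\<lambda>n. (2 * n + 1) ^ k" by (rule cosets_bounded_growth[OF L])
  define M where "M = 2 * (t * r1)"
  define N where "N = 2 * (Suc t * r1)"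
  \<comment> \<open>\<open>M\<close> bounds the components of pieces, \<open>N\<close> is the range in which colours have to be distinct, \<open>m\<close> is the number of colours and \<open>R\<close> the radius on which pieces depend. All positions that are compared lie in the box \<open>S\<close>.\<close>
  define m where "m = (2 * (2 * N) + 1) ^ k * K ^ (2 * N * k) * (2 * (2 * N) + 1) ^ k + 1"
  define R where "R = 2 * (Suc t * r1) * (1 + Suc m * k)"
  define S where "S = R + M + r1"
  from uniform_height[OF L, of K \<eta> "2 * S"]
  obtain h0 where h0: "\<forall>(X :: nat set) f b v x. commuting_maps X k K f \<longrightarrow> (\<forall>v\<in>L. holds f k X (\<eta> v) v) \<longrightarrow>
    v \<in> L \<longrightarrow> v \<in> box k (2 * S) \<longrightarrow> b - diag h0 \<in> cone k \<longrightarrow> x \<in> X \<longrightarrow> act f k (b + v) x = act f k b x" ..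
  define h where "h = h0 + M + r1"
  define H where "H = h0 + S + h + N"
  have "\<exists>G\<subseteq>X. coverable (near f k) G k r (h + M) \<and>
      (\<forall>x\<in>X - G. \<exists>v\<in>supported_box k N - L. act f k (diag H + v) x = act f k (diag H) x)"
    if cm: "commuting_maps X k K f" and hold: "\<forall>v\<in>L. holds f k X (\<eta> v) v" for X :: "nat set" and f
  proof -
    note rel = h0[rule_format, OF cm bspec[OF hold]]
    obtain c where cm_lt: "\<And>x. c x < m" and c: "\<And>y a b. y \<in> X \<Longrightarrow> a \<in> cone k \<inter> box k (2 * N) \<Longrightarrow>
        b \<in> cone k \<inter> box k (2 * N) \<Longrightarrow> c (act f k a y) = c (act f k b y) \<Longrightarrow> act f k a y = act f k b y"
      using ancestor_colouring[OF cm K, of "2 * N"] unfolding m_def by blast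
    \<comment> \<open>The pattern seen from \<open>x\<close>: the colours of the points above \<open>H x\<close>, indexed by cosets of \<open>L\<close>. The choice of the representative does not matter within the box \<open>S\<close>.\<close>
    define \<gamma> where "\<gamma> x A = c (act f k (diag H + rep k L A) x)" for x A
    define P where "P x j = piece (cosets L) (cdist k) r1 t D (\<gamma> x) k j" for x j
    define U where "U j = {x \<in> X. L \<in> P x j}" for j
    note LP = lattice_in_cosets[OF L]
    have \<gamma>_rep: "\<gamma> x A = c (act f k (diag H + w) x)"
      if x: "x \<in> X" and A: "A \<in> cosets L" and w: "w \<in> A" "w \<in> box k S" for x A w
    proof -
      have "cdist k A L \<le> S" using cdist_le[OF w(1) lattice_zero[OF L]] w(2) by simp
      then have "rep k L A \<in> box k S" using rep(2)[OF L A] dist_commute[OF A LP] box_mono by metis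
      then have "rep k L A - w \<in> box k (2 * S)" using box_diff w(2) by (metis mult_2)
      moreover have "rep k L A - w \<in> L"
        using coset_of[OF L A w(1)] rep(1)[OF L A] by (auto simp: coset_def)
      moreover have "(diag H + w) - diag h0 \<in> cone k"
        using w(2) by (rule diag_minus_cone) (simp add: H_def)
      ultimately have "act f k ((diag H + w) + (rep k L A - w)) x = act f k (diag H + w) x"
        by (intro rel x)
      then show ?thesis by (simp add: \<gamma>_def algebra_simps)
    qed
    have \<gamma>_shift: "\<gamma> x A = \<gamma> x0 (translate e A)"
      if x: "x \<in> X" "x0 \<in> X" and e: "e \<in> box k (M + r1)" "act f k (diag h - e) x = act f k (diag h) x0"
        and A: "A \<in> cosets L" "cdist k L A \<le> R" for x x0 e A
    proof -
      let ?w = "rep k L A"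
      have w: "?w \<in> A" "?w \<in> box k R" using rep[OF L A(1)] A(2) box_mono by auto
      have we: "?w + e \<in> box k S" using box_add[OF w(2) e(1)] by (simp add: S_def add.assoc)
      have "diag (H - h) + (?w + e) \<in> cone k" using we by (rule diag_cone) (simp add: H_def)
      moreover have "diag (H - h) = diag H - diag h" by (rule diag_diff) (simp add: H_def)
      ultimately have cone: "diag H - diag h + (?w + e) \<in> cone k" by simp
      have cone': "diag h - e \<in> cone k" using e(1) by (rule diag_cone_minus) (simp add: h_def)
      have "act f k (diag H + ?w) x = act f k ((diag H - diag h + (?w + e)) + (diag h - e)) x"
        by (simp add: algebra_simps)
      also have "\<dots> = act f k (diag H - diag h + (?w + e)) (act f k (diag h - e) x)"
        by (rule act_add[OF cm cone cone' x(1)])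
      also have "\<dots> = act f k (diag H - diag h + (?w + e)) (act f k (diag h) x0)" by (simp add: e(2))
      also have "\<dots> = act f k ((diag H - diag h + (?w + e)) + diag h) x0"
        by (rule act_add[OF cm cone diag_in_cone x(2), symmetric])
      also have "\<dots> = act f k (diag H + (?w + e)) x0" by (simp add: algebra_simps)
      finally have "\<gamma> x A = c (act f k (diag H + (?w + e)) x0)" by (simp add: \<gamma>_def)
      also have "\<dots> = \<gamma> x0 (translate e A)"
        using A(1) w(1) by (intro \<gamma>_rep[OF x(2) _ _ we, symmetric])
          (auto simp: translate_def cosets_def translate_coset[unfolded translate_def])
      finally show ?thesis .
    qed
    have P_shift: "L \<in> P x j \<longleftrightarrow> coset L e \<in> P x0 j"
      if x: "x \<in> X" "x0 \<in> X" and e: "e \<in> box k (M + r1)" "act f k (diag h - e) x = act f k (diag h) x0"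
        and j: "j \<le> k" for x x0 e j
    proof -
      have "L \<in> piece (cosets L) (cdist k) r1 t D (\<gamma> x) k j \<longleftrightarrow>
          translate e L \<in> piece (cosets L) (cdist k) r1 t D (\<gamma> x0) k j"
      proof (rule piece_agree[where m = m])
        show "bij_betw (translate e) (cosets L) (cosets L)" by (rule translate_bij)
        show "cdist k (translate e p) (translate e q) = cdist k p q" if "p \<in> cosets L" "q \<in> cosets L" for p q
          by (rule translate_isometry[OF L that])
        show "\<gamma> x0 q < m" for q using cm_lt by (simp add: \<gamma>_def)
        show "\<gamma> x q = \<gamma> x0 (translate e q)"
          if "q \<in> cosets L" "cdist k L q \<le> 2 * (Suc t * r1) * (1 + Suc m * k)" for q
          using \<gamma>_shift[OF x e that(1)] that(2) by (simp only: R_def)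
      qed (use LP j in auto)
      moreover have "translate e L = coset L e" using translate_coset[of e L 0] coset_zero[OF L] by simp
      ultimately show ?thesis by (simp add: P_def)
    qed
    \<comment> \<open>Along a chain in one set of the cover, \<open>e\<close> is the displacement modulo \<open>L\<close>, and the common point \<open>h x\<^sub>0\<close> stays fixed. Fixing the top rather than comparing \<open>h x\<close> with \<open>x\<^sub>0\<close> avoids a loss of height at each step, so \<open>h\<close> is independent of the length of the chain.\<close>
    have chain: "\<exists>e\<in>box k M. act f k (diag h - e) x = act f k (diag h) x0 \<and> x \<in> U j \<and>
        (L, coset L e) \<in> {(A, B). A \<in> P x0 j \<and> B \<in> P x0 j \<and> cdist k A B \<le> r1}\<^sup>*"
      if j: "j \<le> k" and x0: "x0 \<in> U j"
        and x: "(x0, x) \<in> {(x, y). x \<in> U j \<and> y \<in> U j \<and> near f k r x y}\<^sup>*" for j x0 x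
      using x
    proof (induction rule: rtrancl_induct)
      case base
      show ?case
        by (intro bexI[of _ 0] box_zero) (simp only: coset_zero[OF L] x0 diff_zero rtrancl.rtrancl_refl)
    next
      case (step x x')
      then obtain e where e: "e \<in> box k M" "act f k (diag h - e) x = act f k (diag h) x0"
          "(L, coset L e) \<in> {(A, B). A \<in> P x0 j \<and> B \<in> P x0 j \<and> cdist k A B \<le> r1}\<^sup>*" by blast
      have X: "x0 \<in> X" "x \<in> X" "x' \<in> X" and x': "x' \<in> U j" and nr: "near f k r x x'"
        using step(2) x0 by (auto simp: U_def)
      obtain a b where ab: "a \<in> cone k \<inter> box k r1" "b \<in> cone k \<inter> box k r1" "act f k a x = act f k b x'"
        using nr box_mono[OF r1(2)] unfolding near_def by blast
      define e' where "e' = e + (a - b)"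
      have dif: "a - b \<in> box k r1" using cone_box_diff ab by blast
      have e': "e' \<in> box k (M + r1)" unfolding e'_def using box_add[OF e(1) dif] .
      have ea: "e + a \<in> box k (M + r1)" using box_add e(1) ab(1) by blast
      have cone: "diag h - (e + a) \<in> cone k" using ea by (rule diag_cone_minus) (simp add: h_def)
      have ac: "a \<in> cone k" "b \<in> cone k" using ab by auto
      have "act f k (diag h - e') x' = act f k ((diag h - (e + a)) + b) x'"
        by (simp add: e'_def algebra_simps)
      also have "\<dots> = act f k (diag h - (e + a)) (act f k a x)"
        using act_add[OF cm cone ac(2) X(3)] ab(3) by simp
      also have "\<dots> = act f k ((diag h - (e + a)) + a) x" by (rule act_add[OF cm cone ac(1) X(2), symmetric])
      also have "\<dots> = act f k (diag h) x0" using e(2) by (simp add: algebra_simps)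
      finally have top: "act f k (diag h - e') x' = act f k (diag h) x0" .
      have inP: "coset L e' \<in> P x0 j" using P_shift[OF X(3,1) e' top j] x' by (simp add: U_def)
      have eM: "e \<in> box k (M + r1)" using box_mono[OF _ e(1), of "M + r1"] by simp
      have inP0: "coset L e \<in> P x0 j"
        using P_shift[OF X(2,1) eM e(2) j] step(2) by (simp add: U_def)
      have "cdist k (coset L e) (coset L e') \<le> r1"
        by (rule cdist_le[OF coset_self[OF L] coset_self[OF L]]) (use box_uminus[OF dif] in \<open>simp add: e'_def\<close>)
      then have path: "(L, coset L e') \<in> {(A, B). A \<in> P x0 j \<and> B \<in> P x0 j \<and> cdist k A B \<le> r1}\<^sup>*"
        using e(3) inP inP0 by (auto intro: rtrancl_into_rtrancl)
      have start: "L \<in> P x0 j" using x0 by (simp add: U_def)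
      have "cdist k L (coset L e') \<le> M"
        unfolding M_def by (rule piece_component[OF D(3) D' r1(1) j start[unfolded P_def] path[unfolded P_def]])
      then have "cdist k (coset L e') L \<le> M" using dist_commute[OF LP in_cosets] by simp
      \<comment> \<open>The displacement \<open>e'\<close> may have left the box, but its coset is close to that of the origin, so it has a short representative.\<close>
      then obtain e'' where e'': "e'' \<in> coset L e'" "e'' \<in> box k M"
        using cdist_witness[OF L in_cosets LP _ lattice_zero[OF L]] by auto
      have l: "e'' - e' \<in> L" using e''(1) by (simp add: coset_def)
      have "e'' - e' \<in> box k (2 * S)"
        using box_diff[OF e''(2) e'] by (rule box_mono[rotated]) (simp add: S_def)
      moreover have "diag h + (- e'') - diag h0 \<in> cone k"
        using box_uminus[OF e''(2)] by (rule diag_minus_cone) (simp add: h_def)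
      ultimately have "act f k ((diag h + (- e'')) + (e'' - e')) x' = act f k (diag h + (- e'')) x'"
        by (intro rel l X(3))
      then have "act f k (diag h - e'') x' = act f k (diag h) x0" using top by simp
      moreover have ce: "coset L e'' = coset L e'" using coset_eq[OF L] l by simp
      ultimately show ?case using x' path by (intro bexI[of _ e''] e''(2)) (simp only: ce simp_thms)
    qed
    have "coverable (near f k) (\<Union>j\<le>k. U j) k r (h + M)"
      unfolding coverable_def
    proof (intro exI[of _ U] conjI allI impI ballI refl)
      fix j x0 x assume j: "j \<le> k" and x0: "x0 \<in> U j"
        and x: "(x0, x) \<in> {(x, y). x \<in> U j \<and> y \<in> U j \<and> near f k r x y}\<^sup>*"
      obtain e where e: "e \<in> box k M" "act f k (diag h - e) x = act f k (diag h) x0"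
        using chain[OF j x0 x] by blast
      have "diag h - e \<in> cone k" using e(1) by (rule diag_cone_minus) (simp add: h_def)
      moreover have "diag h - e \<in> box k (h + M)" by (rule box_diff[OF diag_in_box e(1)])
      moreover have "diag h \<in> box k (h + M)" by (rule box_mono[OF _ diag_in_box]) simp
      ultimately show "near f k (h + M) x0 x"
        unfolding near_def using e(2) diag_in_cone by (metis IntI)
    qed
    moreover have "\<exists>v\<in>supported_box k N - L. act f k (diag H + v) x = act f k (diag H) x"
      if x: "x \<in> X - (\<Union>j\<le>k. U j)" for x
    proof -
      have "L \<notin> isolated (cosets L) (cdist k) r1 t (\<gamma> x)"
        using x unfolding piece_cover[where k = k and D = D] by (auto simp: U_def P_def)
      then obtain A where A: "A \<in> cosets L" "cdist k L A \<le> N" "\<gamma> x A = \<gamma> x L" "A \<noteq> L"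
        using LP unfolding isolated_def N_def by blast
      define v where "v = rep k L A"
      have v: "v \<in> A" "v \<in> box k N" using rep[OF L A(1)] box_mono[OF A(2)] by (auto simp: v_def)
      have vL: "v \<notin> L"
      proof
        assume "v \<in> L"
        then have "coset L v = L" using coset_eq[OF L, of v 0] coset_zero[OF L] by simp
        then show False using coset_of[OF L A(1) v(1)] A(4) by simp
      qed
      have xX: "x \<in> X" using x by simp
      have cones: "diag N + v \<in> cone k" "diag (H - N) \<in> cone k"
        using diag_cone[OF v(2) le_refl] diag_in_cone by auto
      have HN: "diag H = diag N + diag (H - N)" by (simp add: diag_add[symmetric] H_def add_ac)
      let ?y = "act f k (diag (H - N)) x"
      have y: "?y \<in> X" by (rule act_closed[OF cm xX])
      have 1: "act f k (diag H + v) x = act f k (diag N + v) ?y"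
        using act_add[OF cm cones xX] unfolding HN by (simp add: add_ac)
      have 2: "act f k (diag H) x = act f k (diag N) ?y"
        using act_add[OF cm diag_in_cone cones(2) xX] unfolding HN .
      have "act f k (diag H + rep k L L) x = act f k (diag H) x"
      proof (rule act_cong)
        have "rep k L L \<in> box k 0" using rep(2)[OF L LP] dist_eq_0[OF LP LP] by simp
        then show "(diag H + rep k L L) j = diag H j" if "j \<in> {1..k}" for j
          using that by (auto simp: box_def)
      qed
      then have "c (act f k (diag N + v) ?y) = c (act f k (diag N) ?y)"
        using A(3) 1 2 by (simp add: \<gamma>_def v_def)
      moreover have "diag N + v \<in> box k (2 * N)" using box_add[OF diag_in_box v(2)] by (simp add: mult_2)
      moreover have "diag N \<in> box k (2 * N)" by (rule box_mono[OF _ diag_in_box]) simp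
      ultimately have "act f k (diag H + v) x = act f k (diag H) x"
        using c[OF y, of "diag N + v" "diag N"] cones(1) diag_in_cone 1 2 by auto
      moreover have "act f k (diag H + truncate k v) x = act f k (diag H + v) x"
        by (rule act_cong) (simp add: truncate_def)
      moreover have "truncate k v \<in> supported_box k N - L" using truncate_box[OF v(2)] lattice_truncate[OF L] vL by simp
      ultimately show ?thesis by metis
    qed
    moreover have "(\<Union>j\<le>k. U j) \<subseteq> X" by (auto simp: U_def)
    ultimately show ?thesis by blast
  qed
  moreover have "N \<le> H" by (simp add: H_def)
  ultimately show ?thesis by blast
qed

section \<open>Induction over the lattice of relations\<close>

text \<open>The bound \<open>D\<close> is chosen before the system, but after the heights \<open>\<eta>\<close>.\<close>

definition controlled :: "nat \<Rightarrow> nat \<Rightarrow> vec set \<Rightarrow> bool" where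
  "controlled k K L \<longleftrightarrow> (\<forall>\<eta> r. \<exists>D. \<forall>(X :: nat set) f. commuting_maps X k K f \<longrightarrow>
     (\<forall>v\<in>L. holds f k X (\<eta> v) v) \<longrightarrow> coverable (near f k) X k r D)"

lemma coverable_empty: "coverable N {} n r D"
  unfolding coverable_def by (intro exI[of _ "\<lambda>_. {}"]) auto

text \<open>The constants have to be found in the order of the scales: \<open>free_points_coverable\<close> produces the finitely many
new relations, and the subsystems which they define are covered one after the other, each at a scale above the
diameters obtained so far, as \<open>coverable_Un\<close> demands.\<close>

lemma controlled_step:
  assumes k: "k \<ge> 1" and K: "K \<ge> 1" and L: "lattice_in k L"
    and IH: "\<And>L'. lattice_in k L' \<Longrightarrow> L \<subset> L' \<Longrightarrow> controlled k K L'"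
  shows "controlled k K L"
  unfolding controlled_def
proof (intro allI)
  fix \<eta> :: "vec \<Rightarrow> nat" and r
  let ?ok = "\<lambda>(X :: nat set) f. commuting_maps X k K f \<and> (\<forall>v\<in>L. holds f k X (\<eta> v) v)"
  obtain D N H where NH: "N \<le> H" and free: "\<And>(X :: nat set) f. ?ok X f \<Longrightarrow>
    \<exists>G\<subseteq>X. coverable (near f k) G k r D \<and>
      (\<forall>x\<in>X - G. \<exists>v\<in>supported_box k N - L. act f k (diag H + v) x = act f k (diag H) x)"
    using free_points_coverable[OF k K L, of \<eta> r] by blast
  let ?Y = "\<lambda>v (X :: nat set) f. {x \<in> X. act f k (diag H + v) x = act f k (diag H) x}"
  have one: "\<exists>E. \<forall>(X :: nat set) f. ?ok X f \<longrightarrow> coverable (near f k) (?Y v X f) k s E"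
    if v: "v \<in> supported_box k N - L" for v s
  proof -
    have "v \<notin> L" "v \<in> box k H" using v NH box_mono by (auto simp: supported_box_def)
    from extend_lattice[OF L this, where K = K and \<eta> = \<eta> and 'a = nat]
    obtain L' \<eta>' where L': "lattice_in k L' \<and> L \<subset> L' \<and> (\<forall>(X :: nat set) f. commuting_maps X k K f \<longrightarrow>
        (\<forall>w\<in>L. holds f k X (\<eta> w) w) \<longrightarrow>
        commuting_maps (?Y v X f) k K f \<and> (\<forall>w\<in>L'. holds f k (?Y v X f) (\<eta>' w) w))"
      by (elim exE) (rule that)
    then have "controlled k K L'" using IH by simp
    then obtain E where E: "\<forall>(X :: nat set) f. commuting_maps X k K f \<longrightarrow>
        (\<forall>w\<in>L'. holds f k X (\<eta>' w) w) \<longrightarrow> coverable (near f k) X k s E"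
      unfolding controlled_def by (elim allE[of _ \<eta>'] allE[of _ s] exE) (rule that)
    have "coverable (near f k) (?Y v X f) k s E" if "?ok X f" for X :: "nat set" and f
    proof -
      have "commuting_maps (?Y v X f) k K f" "\<forall>w\<in>L'. holds f k (?Y v X f) (\<eta>' w) w"
        using L' that by simp_all
      then show ?thesis using E by simp
    qed
    then show ?thesis by (intro exI[of _ E] allI impI)
  qed
  have many: "\<exists>E. \<forall>(X :: nat set) f. ?ok X f \<longrightarrow> coverable (near f k) (\<Union>v\<in>F. ?Y v X f) k s E"
    if "finite F" "F \<subseteq> supported_box k N - L" for F s
    using that
  proof (induction F arbitrary: s rule: finite_induct)
    case empty
    show ?case by (simp add: coverable_empty)
  next
    case (insert v F)
    then obtain E where E: "\<And>(X :: nat set) f. ?ok X f \<Longrightarrow> coverable (near f k) (\<Union>v\<in>F. ?Y v X f) k s E" by blast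
    obtain E' where E': "\<And>(X :: nat set) f. ?ok X f \<Longrightarrow> coverable (near f k) (?Y v X f) k (E + 2 * s) E'"
      using one[of v "E + 2 * s"] insert by blast
    have "coverable (near f k) (\<Union>v\<in>insert v F. ?Y v X f) k s (E' + 2 * (E + s))" if ok: "?ok X f" for X f
    proof -
      interpret nearness "near f k" X using nearness_near ok by blast
      have "coverable (near f k) ((\<Union>v\<in>F. ?Y v X f) \<union> ?Y v X f) k s (E' + 2 * (E + s))"
        by (rule coverable_Un[OF _ _ E[OF ok] E'[OF ok]]) auto
      then show ?thesis by (simp add: Un_commute)
    qed
    then show ?case by blast
  qed
  have "finite (supported_box k N - L)" using finite_supported_box by simp
  from many[OF this subset_refl, of "D + 2 * r"]
  obtain E where E: "\<And>(X :: nat set) f. ?ok X f \<Longrightarrow>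
      coverable (near f k) (\<Union>v\<in>supported_box k N - L. ?Y v X f) k (D + 2 * r) E" by blast
  have "coverable (near f k) X k r (E + 2 * (D + r))" if ok: "?ok X f" for X f
  proof -
    interpret nearness "near f k" X using nearness_near ok by blast
    obtain G where G: "G \<subseteq> X" "coverable (near f k) G k r D"
        "\<forall>x\<in>X - G. \<exists>v\<in>supported_box k N - L. act f k (diag H + v) x = act f k (diag H) x"
      using free[OF ok] by blast
    have "coverable (near f k) (G \<union> (\<Union>v\<in>supported_box k N - L. ?Y v X f)) k r (E + 2 * (D + r))"
      by (rule coverable_Un[OF G(1) _ G(2) E[OF ok]]) auto
    moreover have "G \<union> (\<Union>v\<in>supported_box k N - L. ?Y v X f) = X" using G by blast
    ultimately show ?thesis by simp
  qed
  then show "\<exists>D. \<forall>(X :: nat set) f. commuting_maps X k K f \<longrightarrow>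
     (\<forall>v\<in>L. holds f k X (\<eta> v) v) \<longrightarrow> coverable (near f k) X k r D" by blast
qed

lemma controlled_all:
  assumes "k \<ge> 1" "K \<ge> 1" "lattice_in k L"
  shows "controlled k K L"
  using assms(3)
proof (induction L rule: wf_induct_rule[OF wf_lattices[of k]])
  case (1 L)
  show ?case by (rule controlled_step[OF assms(1,2) 1(2)]) (use 1 in auto)
qed

theorem uniform_near_control:
  assumes "k \<ge> 1" "K \<ge> 1"
  shows "\<exists>D. \<forall>(X :: nat set) f. commuting_maps X k K f \<longrightarrow> coverable (near f k) X k r D"
proof -
  let ?L = "{v :: vec. \<forall>j\<in>{1..k}. v j = 0}"
  have "lattice_in k ?L" by (auto simp: lattice_in_def)
  from controlled_all[OF assms this] obtain D where D: "\<And>(X :: nat set) f. commuting_maps X k K f \<Longrightarrow>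
      (\<forall>v\<in>?L. holds f k X 0 v) \<Longrightarrow> coverable (near f k) X k r D"
    unfolding controlled_def by (elim allE[of _ "\<lambda>_. 0"] allE[of _ r]) blast
  have "holds f k X 0 v" if "v \<in> ?L" for f v and X :: "nat set"
    using that by (auto simp: holds_def box_def intro!: act_cong)
  then show ?thesis using D by blast
qed




section \<open>The graph metric\<close>

definition edge_rel :: "'a set \<Rightarrow> nat \<Rightarrow> (nat \<Rightarrow> 'a \<Rightarrow> 'a) \<Rightarrow> ('a \<times> 'a) set" where
  "edge_rel X k f = {(u, v). {u, v} \<in> maps_edges X k f}"

definition reach :: "'a set \<Rightarrow> nat \<Rightarrow> (nat \<Rightarrow> 'a \<Rightarrow> 'a) \<Rightarrow> nat \<Rightarrow> 'a \<Rightarrow> 'a \<Rightarrow> bool" where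
  "reach X k f n x y \<longleftrightarrow> (\<exists>m\<le>n. (x, y) \<in> edge_rel X k f ^^ m)"

lemma edge_rel_iff: "(u, v) \<in> edge_rel X k f \<longleftrightarrow>
    u \<noteq> v \<and> (\<exists>j\<in>{1..k}. (u \<in> X \<and> v = f j u) \<or> (v \<in> X \<and> u = f j v))"
proof
  assume "(u, v) \<in> edge_rel X k f"
  then show "u \<noteq> v \<and> (\<exists>j\<in>{1..k}. (u \<in> X \<and> v = f j u) \<or> (v \<in> X \<and> u = f j v))"
    by (auto simp: edge_rel_def maps_edges_def doubleton_eq_iff)
next
  assume "u \<noteq> v \<and> (\<exists>j\<in>{1..k}. (u \<in> X \<and> v = f j u) \<or> (v \<in> X \<and> u = f j v))"
  then obtain j where j: "j \<in> {1..k}" and uv: "u \<noteq> v" "u \<in> X \<and> v = f j u \<or> v \<in> X \<and> u = f j v" by blast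
  from uv(2) have "\<exists>x\<in>X. f j x \<noteq> x \<and> {u, v} = {x, f j x}"
  proof (elim disjE conjE)
    assume "u \<in> X" "v = f j u"
    then show ?thesis using uv(1) by (intro bexI[of _ u]) auto
  next
    assume "v \<in> X" "u = f j v"
    then show ?thesis using uv(1) by (intro bexI[of _ v]) auto
  qed
  then show "(u, v) \<in> edge_rel X k f" using j unfolding edge_rel_def maps_edges_def by blast
qed

lemma sym_edge_rel: "sym (edge_rel X k f)"
  unfolding edge_rel_def by (auto intro!: symI simp: insert_commute)

lemma reach_sym:
  assumes "reach X k f n x y" shows "reach X k f n y x"
proof -
  obtain m where m: "m \<le> n" "(x, y) \<in> edge_rel X k f ^^ m" using assms by (auto simp: reach_def)
  have "(u, v) \<in> edge_rel X k f ^^ m \<Longrightarrow> (v, u) \<in> edge_rel X k f ^^ m" for u v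
  proof (induction m arbitrary: v)
    case (Suc m)
    then obtain w where "(u, w) \<in> edge_rel X k f ^^ m" "(w, v) \<in> edge_rel X k f" by auto
    then show ?case by (intro relpow_Suc_I2[OF symD[OF sym_edge_rel] Suc.IH])
  qed simp
  then show ?thesis using m unfolding reach_def by blast
qed

lemma path_metric_le:
  "path_metric (maps_edges X k f) x y \<le> ennreal r \<longleftrightarrow> reach X k f (nat \<lfloor>r\<rfloor>) x y"
proof -
  let ?E = "edge_rel X k f"
  define A where "A = {n. (x, y) \<in> ?E ^^ n}"
  have pm: "path_metric (maps_edges X k f) x y = (INF n\<in>A. of_nat n)"
    by (simp add: path_metric_def A_def edge_rel_def)
  have le: "of_nat n \<le> ennreal r \<longleftrightarrow> n \<le> nat \<lfloor>r\<rfloor>" for n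
  proof (cases "r \<ge> 0")
    case True
    have "of_nat n \<le> ennreal r \<longleftrightarrow> real n \<le> r" using True by (simp add: ennreal_of_nat_eq_real_of_nat)
    also have "\<dots> \<longleftrightarrow> n \<le> nat \<lfloor>r\<rfloor>" using True by (simp add: le_nat_iff le_floor_iff)
    finally show ?thesis .
  next
    case False
    then show ?thesis by (simp add: ennreal_neg)
  qed
  show ?thesis
  proof
    assume *: "path_metric (maps_edges X k f) x y \<le> ennreal r"
    then have ne: "A \<noteq> {}" unfolding pm by (auto simp: top_unique)
    define n where "n = (LEAST n. n \<in> A)"
    have n: "n \<in> A" "\<And>m. m \<in> A \<Longrightarrow> n \<le> m"
      using ne LeastI_ex[of "\<lambda>n. n \<in> A"] Least_le[of "\<lambda>n. n \<in> A"] by (auto simp: n_def)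
    have "of_nat n \<le> (INF n\<in>A. of_nat n :: ennreal)" using n(2) by (intro INF_greatest) simp
    then have "of_nat n \<le> ennreal r" using * unfolding pm by (rule order_trans)
    then show "reach X k f (nat \<lfloor>r\<rfloor>) x y" using n(1) le by (auto simp: reach_def A_def)
  next
    assume "reach X k f (nat \<lfloor>r\<rfloor>) x y"
    then obtain n where "n \<in> A" "n \<le> nat \<lfloor>r\<rfloor>" by (auto simp: reach_def A_def)
    then show "path_metric (maps_edges X k f) x y \<le> ennreal r"
      unfolding pm using le by (intro INF_lower2[of n]) auto
  qed
qed

text \<open>Distances are integers or infinite, so real scales may be rounded down. This is also correct for negative
values of \<open>R\<close>, since both \<open>ennreal\<close> and \<open>nat\<close> send them to \<open>0\<close>.\<close>

lemma asdim_iff_coverable: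
  "asdim_at_most X (path_metric (maps_edges X k f)) n R \<longleftrightarrow>
    (\<forall>r>0. coverable (reach X k f) X n (nat \<lfloor>r\<rfloor>) (nat \<lfloor>R r\<rfloor>))"
proof -
  let ?d = "path_metric (maps_edges X k f)"
  have "(\<forall>C\<in>r_components ?d r A. ext_diameter ?d C \<le> ennreal D) \<longleftrightarrow>
      (\<forall>x\<in>A. \<forall>y. (x, y) \<in> {(x, y). x \<in> A \<and> y \<in> A \<and> reach X k f (nat \<lfloor>r\<rfloor>) x y}\<^sup>* \<longrightarrow>
        reach X k f (nat \<lfloor>D\<rfloor>) x y)" (is "?l \<longleftrightarrow> ?r") for r A D
  proof -
    let ?S = "{(x, y). x \<in> A \<and> y \<in> A \<and> reach X k f (nat \<lfloor>r\<rfloor>) x y}"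
    have comp: "r_components ?d r A = A // ?S\<^sup>*" by (simp add: r_components_def path_metric_le)
    have "sym ?S" using reach_sym by (fastforce intro!: symI)
    note symS = symD[OF sym_rtrancl[OF this]]
    have in_A: "y \<in> A" if "(x, y) \<in> ?S\<^sup>*" "x \<in> A" for x y
      using that by (induction rule: rtrancl_induct) auto
    have diam: "ext_diameter ?d C \<le> ennreal D \<longleftrightarrow> (\<forall>x\<in>C. \<forall>y\<in>C. reach X k f (nat \<lfloor>D\<rfloor>) x y)" for C
      by (auto simp: ext_diameter_def SUP_le_iff path_metric_le)
    show "?l \<longleftrightarrow> ?r"
    proof
      assume l: ?l
      show ?r
      proof (intro ballI allI impI)
        fix x y assume x: "x \<in> A" and xy: "(x, y) \<in> ?S\<^sup>*"
        have "?S\<^sup>* `` {x} \<in> r_components ?d r A" unfolding comp using x by (rule quotientI)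
        then show "reach X k f (nat \<lfloor>D\<rfloor>) x y" using l xy unfolding diam by blast
      qed
    next
      assume r: ?r
      show ?l
      proof
        fix C assume "C \<in> r_components ?d r A"
        then obtain x where x: "x \<in> A" "C = ?S\<^sup>* `` {x}" unfolding comp by (auto elim: quotientE)
        have "reach X k f (nat \<lfloor>D\<rfloor>) u v" if "u \<in> C" "v \<in> C" for u v
        proof -
          have xu: "(x, u) \<in> ?S\<^sup>*" and xv: "(x, v) \<in> ?S\<^sup>*" using that x by auto
          show ?thesis by (rule r[rule_format, OF in_A[OF xu x(1)] rtrancl_trans[OF symS[OF xu] xv]])
        qed
        then show "ext_diameter ?d C \<le> ennreal D" unfolding diam by blast
      qed
    qed
  qed
  then show ?thesis unfolding asdim_at_most_def coverable_def by simp
qed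

definition unit_vec :: "nat \<Rightarrow> vec" where
  "unit_vec j = (\<lambda>i. if i = j then 1 else 0)"

lemma act_unit:
  assumes "j \<in> {1..k}" shows "act f k (unit_vec j) x = f j x"
  using assms
proof (induction k)
  case (Suc k)
  show ?case
  proof (cases "j = Suc k")
    case True
    have "act f k (unit_vec j) x = act f k 0 x" by (rule act_cong) (auto simp: unit_vec_def True)
    then show ?thesis by (simp add: True unit_vec_def act_zero)
  next
    case False
    then show ?thesis using Suc by (simp add: unit_vec_def)
  qed
qed simp

lemma edge_in: "commuting_maps X k K f \<Longrightarrow> (x, y) \<in> edge_rel X k f \<Longrightarrow> x \<in> X \<and> y \<in> X"
  unfolding edge_rel_iff commuting_maps_def by blast

lemma edge_near:
  assumes cm: "commuting_maps X k K f" and e: "(x, y) \<in> edge_rel X k f"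
  shows "near f k 1 x y"
proof -
  have unit: "unit_vec j \<in> cone k \<inter> box k 1" for j by (auto simp: unit_vec_def cone_def box_def)
  have zero: "0 \<in> cone k \<inter> box k 1" by (simp add: cone_def box_def)
  obtain j where "j \<in> {1..k}" "y = f j x \<or> x = f j y" using e unfolding edge_rel_iff by blast
  then have "act f k (unit_vec j) x = act f k 0 y \<or> act f k 0 x = act f k (unit_vec j) y"
    by (auto simp: act_unit act_zero)
  then show ?thesis unfolding near_def using unit zero by blast
qed

lemma reach_near:
  assumes cm: "commuting_maps X k K f" and x: "x \<in> X" and w: "reach X k f n x y"
  shows "near f k n x y"
proof -
  interpret nearness "near f k" X by (rule nearness_near[OF cm])
  have "(x, y) \<in> edge_rel X k f ^^ m \<Longrightarrow> y \<in> X \<and> near f k m x y" for m y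
  proof (induction m arbitrary: y)
    case 0
    then show ?case using x near_refl by auto
  next
    case (Suc m)
    then obtain z where z: "(x, z) \<in> edge_rel X k f ^^ m" "(z, y) \<in> edge_rel X k f" by auto
    have "near f k (m + 1) x y"
      by (rule near_trans[of x z y]) (use x Suc.IH[OF z(1)] z(2) edge_in[OF cm] edge_near[OF cm] in auto)
    then show ?case using edge_in[OF cm z(2)] by simp
  qed
  then show ?thesis using w near_mono x unfolding reach_def by blast
qed

lemma reach_trans: "reach X k f m x y \<Longrightarrow> reach X k f n y z \<Longrightarrow> reach X k f (m + n) x z"
proof -
  assume "reach X k f m x y" "reach X k f n y z"
  then obtain i j where "i \<le> m" "(x, y) \<in> edge_rel X k f ^^ i" "j \<le> n" "(y, z) \<in> edge_rel X k f ^^ j"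
    by (auto simp: reach_def)
  then have "i + j \<le> m + n" "(x, z) \<in> edge_rel X k f ^^ (i + j)" by (auto simp: relpow_add)
  then show ?thesis unfolding reach_def by blast
qed

lemma iterate_reach:
  assumes cm: "commuting_maps X k K f" and j: "j \<in> {1..k}" and x: "x \<in> X"
  shows "reach X k f n x ((f j ^^ n) x)"
proof (induction n)
  case 0
  show ?case by (auto simp: reach_def)
next
  case (Suc n)
  have "(f j ^^ n) x \<in> X" by (rule iterate_closed[OF cm j x])
  then have "(f j ^^ n) x = (f j ^^ Suc n) x \<or> ((f j ^^ n) x, (f j ^^ Suc n) x) \<in> edge_rel X k f"
    using j unfolding edge_rel_iff by auto
  then have "reach X k f 1 ((f j ^^ n) x) ((f j ^^ Suc n) x)"
  proof
    assume "(f j ^^ n) x = (f j ^^ Suc n) x"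
    then show ?thesis unfolding reach_def by (intro exI[of _ 0]) simp
  next
    assume "((f j ^^ n) x, (f j ^^ Suc n) x) \<in> edge_rel X k f"
    then show ?thesis unfolding reach_def by (intro exI[of _ 1]) simp
  qed
  from reach_trans[OF Suc this] show ?case by simp
qed

lemma act_reach:
  assumes cm: "commuting_maps X k K f" and a: "a \<in> box k n" and x: "x \<in> X"
  shows "reach X k f (k * n) x (act f k a x)"
proof -
  have "l \<le> k \<Longrightarrow> reach X k f (l * n) x (act f l a x)" for l
  proof (induction l)
    case 0
    show ?case by (auto simp: reach_def)
  next
    case (Suc l)
    have "commuting_maps X l K f" using cm Suc.prems unfolding commuting_maps_def by auto
    then have X: "act f l a x \<in> X" by (rule act_closed[OF _ x])
    have j: "Suc l \<in> {1..k}" using Suc.prems by simp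
    then have "\<bar>a (Suc l)\<bar> \<le> int n" using a unfolding box_def by blast
    then have "nat (a (Suc l)) \<le> n" by linarith
    then have "reach X k f n (act f l a x) (act f (Suc l) a x)"
      using iterate_reach[OF cm j X, of "nat (a (Suc l))"] unfolding reach_def by (auto intro: le_trans)
    from reach_trans[OF Suc.IH this] Suc.prems show ?case by (simp add: add.commute)
  qed
  then show ?thesis by blast
qed

lemma near_reach:
  assumes cm: "commuting_maps X k K f" and x: "x \<in> X" "y \<in> X" and n: "near f k n x y"
  shows "reach X k f (k * n + k * n) x y"
proof -
  obtain a b where ab: "a \<in> box k n" "b \<in> box k n" "act f k a x = act f k b y"
    using n unfolding near_def by blast
  have "reach X k f (k * n) (act f k a x) y"
    using act_reach[OF cm ab(2) x(2)] reach_sym unfolding ab(3) by metis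
  with act_reach[OF cm ab(1) x(1)] show ?thesis by (rule reach_trans)
qed

lemma coverable_reach:
  assumes cm: "commuting_maps X k K f" and C: "coverable (near f k) X k r D"
  shows "coverable (reach X k f) X k r (k * D + k * D)"
proof -
  obtain U where U: "(\<Union>i\<le>k. U i) = X" and D: "\<And>i x y. i \<le> k \<Longrightarrow> x \<in> U i \<Longrightarrow>
      (x, y) \<in> {(x, y). x \<in> U i \<and> y \<in> U i \<and> near f k r x y}\<^sup>* \<Longrightarrow> near f k D x y"
    using C unfolding coverable_def by blast
  have "reach X k f (k * D + k * D) x y"
    if i: "i \<le> k" and x: "x \<in> U i" and xy: "(x, y) \<in> {(x, y). x \<in> U i \<and> y \<in> U i \<and> reach X k f r x y}\<^sup>*" for i x y
  proof -
    have UX: "U i \<subseteq> X" using U i by blast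
    have "{(x, y). x \<in> U i \<and> y \<in> U i \<and> reach X k f r x y} \<subseteq> {(x, y). x \<in> U i \<and> y \<in> U i \<and> near f k r x y}"
      using reach_near[OF cm] UX by blast
    then have "near f k D x y" using D[OF i x] rtrancl_mono xy by blast
    moreover have "y \<in> U i" using xy x by (induction rule: rtrancl_induct) auto
    ultimately show ?thesis using near_reach[OF cm] UX x by blast
  qed
  then show ?thesis unfolding coverable_def using U by blast
qed

lemma control_exists:
  assumes "k \<ge> 1" "K \<ge> 1"
  shows "\<exists>R. (\<forall>r>0. 0 \<le> R r) \<and> (\<forall>(X :: nat set) f. commuting_maps X k K f \<longrightarrow>
    asdim_at_most X (path_metric (maps_edges X k f)) k R)"
proof -
  have "\<forall>r. \<exists>D. \<forall>(X :: nat set) f. commuting_maps X k K f \<longrightarrow> coverable (reach X k f) X k r D"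
  proof
    fix r
    from uniform_near_control[OF assms, of r] obtain D
      where "\<forall>(X :: nat set) f. commuting_maps X k K f \<longrightarrow> coverable (near f k) X k r D" ..
    then show "\<exists>D. \<forall>(X :: nat set) f. commuting_maps X k K f \<longrightarrow> coverable (reach X k f) X k r D"
      by (intro exI[of _ "k * D + k * D"] allI impI) (rule coverable_reach, simp_all)
  qed
  then obtain D where D: "\<forall>r. \<forall>(X :: nat set) f. commuting_maps X k K f \<longrightarrow> coverable (reach X k f) X k r (D r)"
    by metis
  show ?thesis
    by (rule exI[of _ "\<lambda>r. real (D (nat \<lfloor>r\<rfloor>))"]) (use D in \<open>simp add: asdim_iff_coverable\<close>)
qed

lemma commuting_control:
  assumes "k \<ge> 1" "K \<ge> 1"
  shows "\<And>r. r > 0 \<Longrightarrow> 0 \<le> commuting_control k K r"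
    and "\<And>(X :: nat set) f. commuting_maps X k K f \<Longrightarrow>
      asdim_at_most X (path_metric (maps_edges X k f)) k (commuting_control k K)"
  using someI_ex[OF control_exists[OF assms]] unfolding commuting_control_def[symmetric] by simp_all

section \<open>From sets of natural numbers to arbitrary sets\<close>

definition component :: "'a set \<Rightarrow> nat \<Rightarrow> (nat \<Rightarrow> 'a \<Rightarrow> 'a) \<Rightarrow> 'a \<Rightarrow> 'a set" where
  "component X k f x = (edge_rel X k f)\<^sup>* `` {x}"

lemma countable_component:
  assumes cm: "commuting_maps X k K f"
  shows "countable (component X k f x)"
proof -
  have fin: "finite (edge_rel X k f `` {y})" for y
  proof -
    have "finite {z \<in> X. f j z = y}" if "j \<in> {1..k}" for j
    proof (cases "y \<in> X")
      case True
      then show ?thesis using cm that by (auto simp: commuting_maps_def)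
    next
      case False
      then have "{z \<in> X. f j z = y} = {}" using cm that by (auto simp: commuting_maps_def)
      then show ?thesis by (simp only: finite.emptyI)
    qed
    then have "finite ((\<lambda>j. f j y) ` {1..k} \<union> (\<Union>j\<in>{1..k}. {z \<in> X. f j z = y}))" by auto
    moreover have "edge_rel X k f `` {y} \<subseteq> (\<lambda>j. f j y) ` {1..k} \<union> (\<Union>j\<in>{1..k}. {z \<in> X. f j z = y})"
      by (auto simp: edge_rel_iff)
    ultimately show ?thesis using finite_subset by blast
  qed
  have "finite ((edge_rel X k f ^^ n) `` {x})" for n
  proof (induction n)
    case (Suc n)
    have "(edge_rel X k f ^^ Suc n) `` {x} = (\<Union>y\<in>(edge_rel X k f ^^ n) `` {x}. edge_rel X k f `` {y})"
      by auto
    then show ?case using Suc fin by simp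
  qed simp
  then have "countable (\<Union>n. (edge_rel X k f ^^ n) `` {x})" by (intro countable_UN) (auto intro: countable_finite)
  moreover have "component X k f x = (\<Union>n. (edge_rel X k f ^^ n) `` {x})"
    by (auto simp: component_def rtrancl_is_UN_relpow)
  ultimately show ?thesis by simp
qed

text \<open>A union of components, such as a single one, can be moved along an injection without changing distances.\<close>

lemma transport:
  fixes g :: "'a \<Rightarrow> nat"
  assumes cm: "commuting_maps X k K f" and C: "C \<subseteq> X"
    and closed: "\<And>x j. x \<in> X \<Longrightarrow> j \<in> {1..k} \<Longrightarrow> f j x \<in> C \<longleftrightarrow> x \<in> C"
    and g: "inj_on g C"
  defines "f' \<equiv> \<lambda>j n. g (f j (inv_into C g n))"
  shows "commuting_maps (g ` C) k K f'"
    and "x \<in> C \<Longrightarrow> y \<in> C \<Longrightarrow> reach (g ` C) k f' n (g x) (g y) \<longleftrightarrow> reach X k f n x y"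
proof -
  have f': "f' j (g x) = g (f j x)" if "x \<in> C" for j x using that g by (simp add: f'_def)
  have fC: "f j x \<in> C" if "x \<in> C" "j \<in> {1..k}" for j x using closed[of x j] that C by blast
  have g_eq: "g x = g y \<longleftrightarrow> x = y" if "x \<in> C" "y \<in> C" for x y using inj_on_eq_iff[OF g that] .
  show "commuting_maps (g ` C) k K f'"
    unfolding commuting_maps_def
  proof (intro conjI ballI)
    show "f' j \<in> g ` C \<rightarrow> g ` C" if "j \<in> {1..k}" for j using f' fC that by auto
    show "f' i (f' j n) = f' j (f' i n)" if "i \<in> {1..k}" "j \<in> {1..k}" "n \<in> g ` C" for i j n
    proof -
      from \<open>n \<in> g ` C\<close> obtain x where x: "x \<in> C" "n = g x" by blast
      have "f i (f j x) = f j (f i x)" using cm that x C by (auto simp: commuting_maps_def)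
      then show ?thesis using x f' fC that by simp
    qed
    fix j n assume j: "j \<in> {1..k}" and "n \<in> g ` C"
    then obtain y where y: "y \<in> C" "n = g y" by blast
    have fib: "finite {x \<in> X. f j x = y}" "card {x \<in> X. f j x = y} \<le> K"
      using cm j y C by (auto simp: commuting_maps_def)
    have e: "{m \<in> g ` C. f' j m = n} \<subseteq> g ` {x \<in> X. f j x = y}"
      using f' fC j y g_eq C by auto
    show "finite {m \<in> g ` C. f' j m = n}" using finite_subset[OF e] fib by blast
    show "card {m \<in> g ` C. f' j m = n} \<le> K"
      using card_mono[OF finite_imageI[OF fib(1)] e] card_image_le[OF fib(1), of g] fib(2) by linarith
  qed
  have edge: "(g u, g v) \<in> edge_rel (g ` C) k f' \<longleftrightarrow> (u, v) \<in> edge_rel X k f" if "u \<in> C" "v \<in> C" for u v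
  proof -
    have "g v = f' j (g u) \<longleftrightarrow> v = f j u" "g u = f' j (g v) \<longleftrightarrow> u = f j v" if "j \<in> {1..k}" for j
      using f' fC g_eq \<open>u \<in> C\<close> \<open>v \<in> C\<close> that by simp_all
    then have "((g u \<in> g ` C \<and> g v = f' j (g u)) \<or> (g v \<in> g ` C \<and> g u = f' j (g v))) \<longleftrightarrow>
        ((u \<in> X \<and> v = f j u) \<or> (v \<in> X \<and> u = f j v))" if "j \<in> {1..k}" for j
      using \<open>u \<in> C\<close> \<open>v \<in> C\<close> C that by auto
    moreover have "g u \<noteq> g v \<longleftrightarrow> u \<noteq> v" using g_eq[OF that] by simp
    ultimately show ?thesis unfolding edge_rel_iff by (intro conj_cong bex_cong refl)
  qed
  have out: "v \<in> C" if "u \<in> C" "(u, v) \<in> edge_rel X k f" for u v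
    using that closed C unfolding edge_rel_iff by blast
  have out': "w \<in> g ` C" if "(m, w) \<in> edge_rel (g ` C) k f'" for m w
    using that f' fC unfolding edge_rel_iff by auto
  have pow: "(g x, w) \<in> edge_rel (g ` C) k f' ^^ m \<longleftrightarrow> (\<exists>v\<in>C. w = g v \<and> (x, v) \<in> edge_rel X k f ^^ m)"
    if x: "x \<in> C" for x w m
  proof (induction m arbitrary: w)
    case 0
    show ?case using x by auto
  next
    case (Suc m)
    show ?case
    proof
      assume "(g x, w) \<in> edge_rel (g ` C) k f' ^^ Suc m"
      then obtain u where u: "(g x, u) \<in> edge_rel (g ` C) k f' ^^ m" "(u, w) \<in> edge_rel (g ` C) k f'" by auto
      obtain a where a: "a \<in> C" "u = g a" "(x, a) \<in> edge_rel X k f ^^ m" using Suc u(1) by blast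
      obtain b where b: "b \<in> C" "w = g b" using out'[OF u(2)] by blast
      have "(a, b) \<in> edge_rel X k f" using edge[OF a(1) b(1)] u(2) a(2) b(2) by simp
      then show "\<exists>v\<in>C. w = g v \<and> (x, v) \<in> edge_rel X k f ^^ Suc m" using a b by auto
    next
      assume "\<exists>v\<in>C. w = g v \<and> (x, v) \<in> edge_rel X k f ^^ Suc m"
      then obtain v u where v: "v \<in> C" "w = g v" "(x, u) \<in> edge_rel X k f ^^ m" "(u, v) \<in> edge_rel X k f" by auto
      have "(v, u) \<in> edge_rel X k f" using v(4) sym_edge_rel by (meson symE)
      then have u: "u \<in> C" using out v(1) by blast
      then have "(g x, g u) \<in> edge_rel (g ` C) k f' ^^ m" using Suc v(3) by blast
      moreover have "(g u, w) \<in> edge_rel (g ` C) k f'" using edge[OF u v(1)] v by simp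
      ultimately show "(g x, w) \<in> edge_rel (g ` C) k f' ^^ Suc m" by auto
    qed
  qed
  show "reach (g ` C) k f' n (g x) (g y) \<longleftrightarrow> reach X k f n x y" if "x \<in> C" "y \<in> C"
    using pow[OF that(1)] g_eq that unfolding reach_def by blast
qed

theorem corollary1p3:
  fixes k K :: nat
  assumes "k \<ge> 1" and "K \<ge> 1"
  shows "(\<forall>r>0. 0 \<le> commuting_control k K r) \<and>
    (\<forall>(X :: 'a set) f. commuting_maps X k K f \<longrightarrow>
       asdim_at_most X (path_metric (maps_edges X k f)) k (commuting_control k K))"
proof (intro conjI allI impI)
  show "0 \<le> commuting_control k K r" if "r > 0" for r by (rule commuting_control(1)[OF assms that])
  fix X :: "'a set" and f assume cm: "commuting_maps X k K f"
  show "asdim_at_most X (path_metric (maps_edges X k f)) k (commuting_control k K)"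
    unfolding asdim_iff_coverable
  proof (intro allI impI)
    fix r :: real assume r: "r > 0"
    let ?r = "nat \<lfloor>r\<rfloor>" and ?D = "nat \<lfloor>commuting_control k K r\<rfloor>"
    let ?comp = "component X k f"
    have comp_eq: "?comp x = ?comp y" if "(x, y) \<in> edge_rel X k f" for x y
    proof -
      have "(y, x) \<in> edge_rel X k f" using that sym_edge_rel by (meson symE)
      then show ?thesis using that unfolding component_def
        by (auto intro: converse_rtrancl_into_rtrancl)
    qed
    have comp_in: "?comp y = ?comp x" if "y \<in> ?comp x" for x y
    proof -
      have "(x, y) \<in> (edge_rel X k f)\<^sup>*" using that by (simp add: component_def)
      then show ?thesis by (induction rule: rtrancl_induct) (auto dest: comp_eq)
    qed
    have comp_sub: "?comp x \<subseteq> X" if "x \<in> X" for x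
    proof
      fix y assume "y \<in> ?comp x"
      then have "(x, y) \<in> (edge_rel X k f)\<^sup>*" by (simp add: component_def)
      then show "y \<in> X" using that edge_in[OF cm] by (induction rule: rtrancl_induct) auto
    qed
    have self: "x \<in> ?comp x" for x by (simp add: component_def)
    have comp_closed: "f j y \<in> ?comp x \<longleftrightarrow> y \<in> ?comp x" if "y \<in> X" "j \<in> {1..k}" for x y j
    proof (cases "f j y = y")
      case False
      then have "(y, f j y) \<in> edge_rel X k f" unfolding edge_rel_iff using that by auto
      then show ?thesis using comp_eq comp_in self by metis
    qed simp
    have local: "coverable (reach X k f) C k ?r ?D" if C: "C \<in> ?comp ` X" for C
    proof -
      obtain x where x: "x \<in> X" "C = ?comp x" using C by blast
      have CX: "C \<subseteq> X" using comp_sub x by blast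
      obtain g :: "'a \<Rightarrow> nat" where g: "inj_on g C"
        using countable_component[OF cm] x(2) by (auto simp: countable_def)
      define f' where "f' = (\<lambda>j n. g (f j (inv_into C g n)))"
      have cl: "f j y \<in> C \<longleftrightarrow> y \<in> C" if "y \<in> X" "j \<in> {1..k}" for y j
        using comp_closed that unfolding x(2) by blast
      note tr = transport[OF cm CX cl g, folded f'_def]
      have "coverable (reach (g ` C) k f') (g ` C) k ?r ?D"
        using commuting_control(2)[OF assms tr(1)] r unfolding asdim_iff_coverable by blast
      then obtain U where U: "(\<Union>i\<le>k. U i) = g ` C" and D: "\<And>i x y. i \<le> k \<Longrightarrow> x \<in> U i \<Longrightarrow>
          (x, y) \<in> {(x, y). x \<in> U i \<and> y \<in> U i \<and> reach (g ` C) k f' ?r x y}\<^sup>* \<Longrightarrow> reach (g ` C) k f' ?D x y"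
        by (rule coverable_cases) (rule that)
      define W where "W i = {x \<in> C. g x \<in> U i}" for i
      have "reach X k f ?D x y" if i: "i \<le> k" and x: "x \<in> W i"
        and xy: "(x, y) \<in> {(x, y). x \<in> W i \<and> y \<in> W i \<and> reach X k f ?r x y}\<^sup>*" for i x y
      proof -
        have "y \<in> W i \<and> (g x, g y) \<in> {(x, y). x \<in> U i \<and> y \<in> U i \<and> reach (g ` C) k f' ?r x y}\<^sup>*"
          using xy
        proof (induction rule: rtrancl_induct)
          case base
          show ?case using x by simp
        next
          case (step y z)
          then have "(g y, g z) \<in> {(x, y). x \<in> U i \<and> y \<in> U i \<and> reach (g ` C) k f' ?r x y}"
            using tr(2) by (auto simp: W_def)
          then show ?case using step by (auto intro: rtrancl_into_rtrancl)
        qed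
        then have "reach (g ` C) k f' ?D (g x) (g y)" "y \<in> C" using D[OF i, of "g x" "g y"] x by (auto simp: W_def)
        then show ?thesis using tr(2) x by (auto simp: W_def)
      qed
      moreover have "(\<Union>i\<le>k. W i) = C" using U by (auto simp: W_def)
      ultimately show ?thesis unfolding coverable_def by blast
    qed
    then have "\<forall>C\<in>?comp ` X. \<exists>U. (\<Union>i\<le>k. U i) = C \<and> (\<forall>i\<le>k. \<forall>x\<in>U i. \<forall>y.
        (x, y) \<in> {(x, y). x \<in> U i \<and> y \<in> U i \<and> reach X k f ?r x y}\<^sup>* \<longrightarrow> reach X k f ?D x y)"
      unfolding coverable_def by blast
    from bchoice[OF this] obtain U where choice: "\<forall>C\<in>?comp ` X. (\<Union>i\<le>k. U C i) = C \<and> (\<forall>i\<le>k. \<forall>x\<in>U C i. \<forall>y.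
        (x, y) \<in> {(x, y). x \<in> U C i \<and> y \<in> U C i \<and> reach X k f ?r x y}\<^sup>* \<longrightarrow> reach X k f ?D x y)" ..
    note U = conjunct1[OF bspec[OF choice]] and D = conjunct2[OF bspec[OF choice], rule_format]
    define W where "W i = (\<Union>C\<in>?comp ` X. U C i)" for i
    have UC: "U C i \<subseteq> C" if "C \<in> ?comp ` X" "i \<le> k" for C i using U that by blast
    have W_comp: "x \<in> U (?comp x) i" if x: "x \<in> W i" and i: "i \<le> k" for x i
    proof -
      obtain z where z: "z \<in> X" "x \<in> U (?comp z) i" using x by (auto simp: W_def)
      then have "?comp x = ?comp z" using UC[OF _ i, of "?comp z"] by (intro comp_in) auto
      then show ?thesis using z by simp
    qed
    have UX: "(\<Union>i\<le>k. W i) = X"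
    proof
      show "(\<Union>i\<le>k. W i) \<subseteq> X" using UC comp_sub unfolding W_def by fastforce
      show "X \<subseteq> (\<Union>i\<le>k. W i)"
      proof
        fix x assume x: "x \<in> X"
        have "x \<in> (\<Union>i\<le>k. U (?comp x) i)" unfolding U[OF imageI[OF x]] by (rule self)
        then show "x \<in> (\<Union>i\<le>k. W i)" using x unfolding W_def by blast
      qed
    qed
    have "reach X k f ?D x y" if i: "i \<le> k" and x: "x \<in> W i"
      and xy: "(x, y) \<in> {(x, y). x \<in> W i \<and> y \<in> W i \<and> reach X k f ?r x y}\<^sup>*" for i x y
    proof -
      let ?C = "?comp x"
      have xX: "x \<in> X" using x i UX by blast
      have "(x, y) \<in> {(x, y). x \<in> U ?C i \<and> y \<in> U ?C i \<and> reach X k f ?r x y}\<^sup>* \<and> ?comp y = ?C"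
        using xy
      proof (induction rule: rtrancl_induct)
        case (step y z)
        have yz: "y \<in> W i" "z \<in> W i" "reach X k f ?r y z" using step(2) by auto
        then have "(y, z) \<in> (edge_rel X k f)\<^sup>*" by (auto simp: reach_def rtrancl_is_UN_relpow)
        then have "?comp z = ?comp y" using comp_in[of z y] by (simp add: component_def)
        then have "?comp z = ?C" using step.IH by simp
        then have "y \<in> U ?C i" "z \<in> U ?C i" using W_comp[OF _ i] yz(1,2) step.IH by metis+
        then show ?case using step.IH yz(3) \<open>?comp z = ?C\<close> by (auto intro: rtrancl_into_rtrancl)
      qed simp
      then show ?thesis using D[of ?C i x y] xX i W_comp[OF x i] by blast
    qed
    then show "coverable (reach X k f) X k ?r ?D" unfolding coverable_def using UX by blast
  qed
qed


end
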